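(* Let $S$ be a commutative semigroup that generates a divisible group $G = \langle S\rangle$, let $E$ be a (real) Banach lattice with order continuous norm, and let $\mathcal{T} = (T_t)_{t\in S}\subseteq \mathcal{L}(E)$ be a positive and bounded representation of $S$ on $E$. Assume that $\mathcal{T}$ possesses a quasi-interior fixed point $y\in E_+$ and that $\mathcal{T}$ has the following two properties: (a) Every super fixed point of $\mathcal{T}$ is a fixed point of $\mathcal{T}$. (b) For every fixed point $x > 0$ of $\mathcal{T}$ there exist $s\in S$ and an AM-compact operator $K \geq 0$ on $E$ such that $T_s \geq K$ and $Kx>0$. Then $\mathcal{T}$ is strongly convergent.
   Context: All Banach lattices are real. For a vector $f$, $f>0$ means $f\ge0$ and $f\ne0$. A representation of a (commutative, additively written) semigroup $S$ on a Banach space $E$ is a family $(T_t)_{t\in S}\subseteq\mathcal{L}(E)$ of bounded linear operators with $T_{t+s}=T_tT_s$ for all $t,s\in S$. It is bounded if $\sup_{t\in S}\|T_t\|<\infty$ and positive if each $T_t$ is a positive operator. For operators, $T\ge K$ means that $T-K$ is positive. A commutative semigroup $S$ generates a group $G$ if $S$ embeds into a group (equivalently $S$ is cancellative) and, viewing $S$ as a subset of that group, $G=\langle S\rangle$ is the smallest subgroup containing $S$ (unique up to isomorphism). A group $G$ is divisible if for every $t\in G$ and every $n\in\{1,2,\dots\}$ there is $s\in G$ with $s^n=t$ (additively: $ns=t$). A fixed point of $\mathcal T$ is a vector $x$ with $T_tx=x$ for all $t\in S$. A super fixed point of $\mathcal T$ is a vector $x\ge0$ with $T_tx\ge x$ for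 all $t\in S$. A vector $y\in E_+$ is a quasi-interior point of $E_+$ if the principal ideal $E_y=\{g\in E:\exists c\ge0,\ |g|\le cy\}$ is dense in $E$; a quasi-interior fixed point is a fixed point of $\mathcal T$ that is a quasi-interior point of $E_+$. A linear operator $T:E\to Y$ from a Banach lattice to a Banach space is AM-compact if it maps order intervals $[f,g]=\{x\in E: f\le x\le g\}$ to relatively compact subsets of $Y$. $S$ is directed by $s\le t :\Leftrightarrow t=s$ or $t=s+r$ for some $r\in S$. The representation is strongly convergent if for every $x\in E$ the net $(T_tx)_{t\in S}$ converges in norm in $E$. *)

theory Defs
  imports
    "HOL-Analysis.Analysis"
    "HOL-Library.Lattice_Algebras"
    "HOL-Computational_Algebra.Group_Closure"
begin

class banach_lattice = banach + ordered_real_vector + lattice_ab_group_add_abs +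
  assumes norm_lattice_mono: "\<bar>x\<bar> \<le> \<bar>y\<bar> \<Longrightarrow> norm x \<le> norm y"

(* A set directed downwards with infimum 0 converges in norm to 0, as a decreasing net indexed
   by itself. *)
definition order_continuous_norm :: "'a::banach_lattice itself \<Rightarrow> bool" where
  "order_continuous_norm (_::'a itself) \<longleftrightarrow>
    (\<forall>D::'a set. D \<noteq> {} \<and> (\<forall>x\<in>D. \<forall>y\<in>D. \<exists>z\<in>D. z \<le> x \<and> z \<le> y) \<and>
       (\<forall>x\<in>D. 0 \<le> x) \<and> (\<forall>b. (\<forall>x\<in>D. b \<le> x) \<longrightarrow> b \<le> 0)
       \<longrightarrow> ((\<lambda>x. x) \<longlongrightarrow> 0) (INF x\<in>D. principal {z\<in>D. z \<le> x}))"

definition principal_ideal :: "'a::banach_lattice \<Rightarrow> 'a set" where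
  "principal_ideal y = {g. \<exists>c\<ge>0. \<bar>g\<bar> \<le> c *\<^sub>R y}"

definition quasi_interior_point :: "'a::banach_lattice \<Rightarrow> bool" where
  "quasi_interior_point y \<longleftrightarrow> 0 \<le> y \<and> closure (principal_ideal y) = UNIV"

definition positive_operator :: "('a::banach_lattice \<Rightarrow> 'b::banach_lattice) \<Rightarrow> bool" where
  "positive_operator f \<longleftrightarrow> linear f \<and> (\<forall>x\<ge>0. 0 \<le> f x)"

definition AM_compact :: "('a::banach_lattice \<Rightarrow> 'b::banach) \<Rightarrow> bool" where
  "AM_compact f \<longleftrightarrow> linear f \<and> (\<forall>a b. compact (closure (f ` {a..b})))"

(* The group is abelian: a group generated by a commutative semigroup always is. *)
definition generates_group :: "('s::ab_semigroup_add \<Rightarrow> 'g::ab_group_add) \<Rightarrow> bool" where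
  "generates_group \<iota> \<longleftrightarrow>
    inj \<iota> \<and> (\<forall>s t. \<iota> (s + t) = \<iota> s + \<iota> t) \<and> group_closure (range \<iota>) = UNIV"

definition divisible_group :: "'g::ab_group_add itself \<Rightarrow> bool" where
  "divisible_group (_::'g itself) \<longleftrightarrow> (\<forall>t::'g. \<forall>n::nat. n \<ge> 1 \<longrightarrow> (\<exists>s. (\<Sum>i<n. s) = t))"

definition representation ::
    "('s::ab_semigroup_add \<Rightarrow> 'a::real_normed_vector \<Rightarrow>\<^sub>L 'a) \<Rightarrow> bool" where
  "representation T \<longleftrightarrow> (\<forall>t s. T (t + s) = T t o\<^sub>L T s)"

definition bounded_representation ::
    "('s::ab_semigroup_add \<Rightarrow> 'a::real_normed_vector \<Rightarrow>\<^sub>L 'a) \<Rightarrow> bool" where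
  "bounded_representation T \<longleftrightarrow> representation T \<and> bounded (range T)"

definition positive_representation ::
    "('s::ab_semigroup_add \<Rightarrow> 'a::banach_lattice \<Rightarrow>\<^sub>L 'a) \<Rightarrow> bool" where
  "positive_representation T \<longleftrightarrow>
    representation T \<and> (\<forall>t. positive_operator (blinfun_apply (T t)))"

definition fixed_point ::
    "('s::ab_semigroup_add \<Rightarrow> 'a::real_normed_vector \<Rightarrow>\<^sub>L 'a) \<Rightarrow> 'a \<Rightarrow> bool" where
  "fixed_point T x \<longleftrightarrow> (\<forall>t. blinfun_apply (T t) x = x)"

definition super_fixed_point ::
    "('s::ab_semigroup_add \<Rightarrow> 'a::banach_lattice \<Rightarrow>\<^sub>L 'a) \<Rightarrow> 'a \<Rightarrow> bool" where
  "super_fixed_point T x \<longleftrightarrow> 0 \<le> x \<and> (\<forall>t. x \<le> blinfun_apply (T t) x)"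

definition semigroup_le :: "'s::ab_semigroup_add \<Rightarrow> 's \<Rightarrow> bool" where
  "semigroup_le s t \<longleftrightarrow> t = s \<or> (\<exists>r. t = s + r)"

(* Convergence along this filter is convergence of nets indexed by the directed set S. *)
definition semigroup_at_top :: "'s::ab_semigroup_add filter" where
  "semigroup_at_top = (INF s. principal {t. semigroup_le s t})"

lemma eventually_semigroup_at_top:
  "eventually P (semigroup_at_top :: 's::ab_semigroup_add filter) \<longleftrightarrow>
    (\<exists>s. \<forall>t. semigroup_le s t \<longrightarrow> P t)"
proof -
  have "\<exists>x. {t. semigroup_le x t} \<subseteq> {t. semigroup_le a t} \<inter> {t. semigroup_le b t}"
    for a b :: 's
    by (rule exI[of _ "a + b"], auto simp: semigroup_le_def) (metis add.assoc add.commute)+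
  then show ?thesis
    unfolding semigroup_at_top_def
    by (subst eventually_INF_base) (auto simp: eventually_principal)
qed

definition strongly_convergent ::
    "('s::ab_semigroup_add \<Rightarrow> 'a::real_normed_vector \<Rightarrow>\<^sub>L 'a) \<Rightarrow> bool" where
  "strongly_convergent T \<longleftrightarrow>
    (\<forall>x. \<exists>z. ((\<lambda>t. blinfun_apply (T t) x) \<longlongrightarrow> z) semigroup_at_top)"

end

theory Submission
  imports Defs
begin

text \<open>The order interval \<open>[-y, y]\<close> is invariant. Property (b), applied to the infimum of all \<open>v\<close> such
  that some \<open>T t\<close> maps \<open>[-y, y]\<close> into a finite union of translates of \<open>[-v, v]\<close> up to small errors, shows
  that the images of \<open>[-y, y]\<close> become totally bounded along the semigroup; by (a) that infimum is a
  fixed point. A Jacobs--de Leeuw--Glicksberg argument then produces a space \<open>L\<close> of reversible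
  vectors with norm compact order intervals on which every \<open>T t\<close> is a bijective isometry for an
  equivalent norm, while the other component of an orbit tends to zero. By (a) no positive vector
  \<open>u \<noteq> 0\<close> below \<open>y\<close> has an orbit that tends to zero, so \<open>L\<close> is a sublattice of the whole space.
  Compactness of the order intervals makes \<open>L\<close> atomic; the operators permute the finitely many
  atoms below \<open>y\<close> of a given norm, and a divisible group acts trivially on a finite set. Hence all
  atoms, and with them all of \<open>L\<close>, are fixed.\<close>

section \<open>Banach lattices\<close>

text \<open>Compact order intervals do not yield atoms for free: a diffuse part has to be excluded.
  In an interval without atoms a component can be halved independently of any finite family of
  components, so it keeps a fixed distance from all of them and no finite net exists. Permuting
  atoms is a matter of the semigroup, which lacks inverses. Divisibility is therefore brought into
  the form \<open>s + m v = m u\<close>; with \<open>m\<close> the factorial of the number of atoms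
  in question, both multiples act trivially on them, and so does \<open>s\<close>. Fixed atoms do
  not give fixed vectors through an expansion into atoms. Instead, the defect
  \<open>x - inf x (T s x)\<close> of a positive \<open>x\<close> in \<open>L\<close> dominates no
  atom, hence vanishes; this makes \<open>x\<close> a super fixed point, and (a) is used once more.
  All estimates are uniform on the interval \<open>[-y, y]\<close> and are transported to its
  multiples by scaling. The splitting thus lives on the principal ideal of \<open>y\<close>, and its
  density enters only in the last limit.\<close>

declare neg_inf_eq_sup [simp del] neg_sup_eq_inf [simp del]
  diff_inf_eq_sup [simp del] diff_sup_eq_inf [simp del]

lemma sup_lipschitz: "\<bar>sup a c - sup b c\<bar> \<le> \<bar>a - b\<bar>"
  for a b c :: "'a::lattice_ab_group_add_abs"
proof -
  have "sup a c \<le> \<bar>a - b\<bar> + sup b c" for a b :: 'a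
  proof (rule sup_least)
    have "a = (a - b) + b" by simp
    also have "\<dots> \<le> \<bar>a - b\<bar> + sup b c" by (intro add_mono abs_ge_self sup_ge1)
    finally show "a \<le> \<bar>a - b\<bar> + sup b c" .
    show "c \<le> \<bar>a - b\<bar> + sup b c" by (rule add_increasing) auto
  qed
  from this[of a b] this[of b a] show ?thesis
    by (intro abs_leI) (simp_all add: diff_le_eq abs_minus_commute)
qed

lemma inf_lipschitz: "\<bar>inf a c - inf b c\<bar> \<le> \<bar>a - b\<bar>"
  for a b c :: "'a::lattice_ab_group_add_abs"
proof -
  have "inf a c - inf b c = - (sup (- a) (- c) - sup (- b) (- c))"
    unfolding inf_eq_neg_sup by simp
  then have "\<bar>inf a c - inf b c\<bar> = \<bar>sup (- a) (- c) - sup (- b) (- c)\<bar>"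
    by (simp only: abs_minus_cancel)
  also have "\<dots> \<le> \<bar>- a - - b\<bar>" by (rule sup_lipschitz)
  finally show ?thesis by (simp add: abs_minus_commute)
qed

lemma norm_mono_nonneg: "0 \<le> x \<Longrightarrow> x \<le> y \<Longrightarrow> norm x \<le> norm y"
  for x :: "'a::banach_lattice"
  by (rule norm_lattice_mono) (simp add: abs_of_nonneg order_trans[of 0 x y])

lemma norm_abs_lattice [simp]: "norm \<bar>x\<bar> = norm x" for x :: "'a::banach_lattice"
  by (intro antisym norm_lattice_mono) auto

lemma norm_le_abs_le: "\<bar>x\<bar> \<le> y \<Longrightarrow> norm x \<le> norm y" for x :: "'a::banach_lattice"
  using norm_mono_nonneg[OF abs_ge_zero, of x y] by simp

lemma norm_inf_diff_le: "norm (inf a c - inf b c) \<le> norm (a - b)" for a :: "'a::banach_lattice"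
  by (rule norm_lattice_mono) (rule inf_lipschitz)

lemma norm_sup_diff_le: "norm (sup a c - sup b c) \<le> norm (a - b)" for a :: "'a::banach_lattice"
  by (rule norm_lattice_mono) (rule sup_lipschitz)

lemma norm_pprt_le: "norm (pprt a) \<le> norm a" for a :: "'a::banach_lattice"
  using norm_sup_diff_le[of a 0 0] by (simp add: pprt_def)

lemma continuous_on_inf_left: "continuous_on S (\<lambda>x. inf x c)" for c :: "'a::banach_lattice"
  unfolding continuous_on_iff dist_norm
proof (intro ballI allI impI)
  fix x :: 'a and e :: real assume "e > 0"
  then show "\<exists>d>0. \<forall>x'\<in>S. norm (x' - x) < d \<longrightarrow> norm (inf x' c - inf x c) < e"
    by (intro exI[of _ e]) (simp add: order_le_less_trans[OF norm_inf_diff_le])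
qed

lemma tendsto_inf_left:
  "X \<longlonglongrightarrow> x \<Longrightarrow> (\<lambda>n. inf (X n) c) \<longlonglongrightarrow> inf x c" for c :: "'a::banach_lattice"
  using continuous_on_tendsto_compose[OF continuous_on_inf_left[of UNIV c], of X x sequentially]
  by simp

lemma LIMSEQ_norm_diff_le:
  fixes X :: "nat \<Rightarrow> 'a::real_normed_vector"
  assumes "\<And>n. norm (X n - x) \<le> g n" "g \<longlonglongrightarrow> 0" shows "X \<longlonglongrightarrow> x"
proof (rule LIM_zero_cancel, rule Lim_null_comparison[OF _ assms(2)])
  show "\<forall>\<^sub>F n in sequentially. norm (X n - x) \<le> g n"
    using assms(1) by simp
qed

lemma tendsto_inf_lattice:
  fixes x y :: "'a::banach_lattice"
  assumes "X \<longlonglongrightarrow> x" "Y \<longlonglongrightarrow> y"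
  shows "(\<lambda>n. inf (X n) (Y n)) \<longlonglongrightarrow> inf x y"
proof -
  have "norm (inf (X n) (Y n) - inf x y) \<le> norm (X n - x) + norm (Y n - y)" for n
  proof -
    have "inf (X n) (Y n) - inf x y = (inf (X n) (Y n) - inf x (Y n)) + (inf (Y n) x - inf y x)"
      unfolding inf_commute[of _ x] by (simp only: add_diff_eq diff_add_cancel)
    also have "norm \<dots> \<le> norm (inf (X n) (Y n) - inf x (Y n)) + norm (inf (Y n) x - inf y x)"
      by (rule norm_triangle_ineq)
    finally show ?thesis
      using norm_inf_diff_le[of "X n" "Y n" x] norm_inf_diff_le[of "Y n" x y] by linarith
  qed
  moreover have "(\<lambda>n. norm (X n - x) + norm (Y n - y)) \<longlonglongrightarrow> 0 + 0"
    by (intro tendsto_add) (rule tendsto_norm_zero, rule LIM_zero, rule assms)+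
  ultimately have "(\<lambda>n. inf (X n) (Y n) - inf x y) \<longlonglongrightarrow> 0"
    using Lim_null_comparison[OF always_eventually] by (metis (no_types, lifting) add_0)
  then show ?thesis by (rule LIM_zero_cancel)
qed

lemma tendsto_abs_lattice: "X \<longlonglongrightarrow> x \<Longrightarrow> (\<lambda>n. \<bar>X n\<bar>) \<longlonglongrightarrow> \<bar>x\<bar>" for x :: "'a::banach_lattice"
  unfolding abs_lattice sup_eq_neg_inf minus_minus
  by (intro tendsto_minus tendsto_inf_lattice)

lemma tendsto_nonneg_lattice:
  assumes "X \<longlonglongrightarrow> x" "\<And>n. 0 \<le> X n" shows "0 \<le> (x::'a::banach_lattice)"
proof -
  have "(\<lambda>n. inf (X n) 0) \<longlonglongrightarrow> inf x 0"
    using assms(1) by (rule tendsto_inf_left)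
  moreover have "inf (X n) 0 = 0" for n
    using assms(2) by (simp add: inf_absorb2)
  ultimately have "inf x 0 = 0"
    by (simp add: LIMSEQ_const_iff)
  then show ?thesis by (simp add: le_iff_inf inf_commute)
qed

lemma tendsto_le_lattice:
  assumes "X \<longlonglongrightarrow> x" "Y \<longlonglongrightarrow> y" "\<And>n. X n \<le> Y n" shows "x \<le> (y::'a::banach_lattice)"
proof -
  have "0 \<le> y - x"
    by (rule tendsto_nonneg_lattice[OF tendsto_diff[OF assms(2,1)]]) (simp add: assms(3))
  then show ?thesis by simp
qed

lemma closed_atLeast_lattice: "closed {x. (a::'a::banach_lattice) \<le> x}"
  unfolding closed_sequential_limits using tendsto_le_lattice[OF tendsto_const] by auto

lemma closed_atMost_lattice: "closed {x. x \<le> (a::'a::banach_lattice)}"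
  unfolding closed_sequential_limits using tendsto_le_lattice[OF _ tendsto_const] by auto

lemma closed_abs_le: "closed {x. \<bar>x\<bar> \<le> (a::'a::banach_lattice)}"
proof -
  have "{x. \<bar>x\<bar> \<le> a} = {x. x \<le> a} \<inter> {x. - a \<le> x}"
    using abs_le_iff minus_le_iff[of _ a] by blast
  then show ?thesis
    by (simp add: closed_Int closed_atLeast_lattice closed_atMost_lattice)
qed

section \<open>Scalar multiples, disjointness and principal ideals\<close>

lemma scaleR_inf:
  fixes a b :: "'a::banach_lattice"
  assumes "0 \<le> c" shows "c *\<^sub>R inf a b = inf (c *\<^sub>R a) (c *\<^sub>R b)"
proof (cases "c = 0")
  case False
  then have c: "c > 0" using assms by simp
  show ?thesis
  proof (rule antisym)
    show "c *\<^sub>R inf a b \<le> inf (c *\<^sub>R a) (c *\<^sub>R b)"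
      using assms by (simp add: scaleR_left_mono)
    have cancel: "(1 / c) *\<^sub>R (c *\<^sub>R v) = v" for v :: 'a using c by simp
    have "(1 / c) *\<^sub>R inf (c *\<^sub>R a) (c *\<^sub>R b) \<le> (1 / c) *\<^sub>R (c *\<^sub>R a)"
         "(1 / c) *\<^sub>R inf (c *\<^sub>R a) (c *\<^sub>R b) \<le> (1 / c) *\<^sub>R (c *\<^sub>R b)"
      using c by (intro scaleR_left_mono inf_le1 inf_le2; simp)+
    then have "(1 / c) *\<^sub>R inf (c *\<^sub>R a) (c *\<^sub>R b) \<le> inf a b"
      unfolding cancel by (rule le_infI)
    from scaleR_left_mono[OF this assms] show "inf (c *\<^sub>R a) (c *\<^sub>R b) \<le> c *\<^sub>R inf a b"
      using c by simp
  qed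
qed simp

lemma abs_scaleR_lattice: "\<bar>c *\<^sub>R x\<bar> = \<bar>c\<bar> *\<^sub>R \<bar>x\<bar>" for x :: "'a::banach_lattice"
proof -
  have *: "\<bar>c *\<^sub>R x\<bar> = c *\<^sub>R \<bar>x\<bar>" if "c \<ge> 0" for c
    unfolding abs_lattice sup_eq_neg_inf minus_minus scaleR_minus_right
    using scaleR_inf[OF that, of "- x" x] by simp
  show ?thesis
    using *[of c] *[of "- c"] by (cases "c \<ge> 0") auto
qed

text \<open>The Archimedean property, a consequence of the closed positive cone: divide by
  \<open>n + 1\<close> and pass to the limit.\<close>

lemma le_zero_of_multiples_le:
  fixes a b :: "'a::banach_lattice"
  assumes "\<And>n. real n *\<^sub>R a \<le> b" shows "a \<le> 0"
proof (rule tendsto_le_lattice)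
  show "(\<lambda>n. a) \<longlonglongrightarrow> a" by simp
  show "(\<lambda>n. inverse (real (Suc n)) *\<^sub>R b) \<longlonglongrightarrow> 0"
    using tendsto_scaleR[OF LIMSEQ_inverse_real_of_nat tendsto_const[of b]] by simp
  show "a \<le> inverse (real (Suc n)) *\<^sub>R b" for n
    using scaleR_left_mono[OF assms[of "Suc n"], of "inverse (real (Suc n))"]
    by (simp del: of_nat_Suc)
qed

text \<open>Both arguments may be enlarged by the factor \<open>1 + c\<close>, which can then be
  pulled out of the infimum.\<close>

lemma inf_zero_scaleR:
  fixes a b :: "'a::banach_lattice"
  assumes "inf a b = 0" "0 \<le> c" shows "inf (c *\<^sub>R a) b = 0"
proof -
  have a: "0 \<le> a" "0 \<le> b" by (metis assms(1) inf_le1, metis assms(1) inf_le2)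
  have "inf (c *\<^sub>R a) b \<le> inf ((1 + c) *\<^sub>R a) ((1 + c) *\<^sub>R b)"
  proof (rule inf_mono)
    show "c *\<^sub>R a \<le> (1 + c) *\<^sub>R a" using a by (intro scaleR_right_mono) auto
    show "b \<le> (1 + c) *\<^sub>R b" using scaleR_right_mono[of 1 "1 + c" b] a assms(2) by simp
  qed
  also have "\<dots> = 0"
    using scaleR_inf[of "1 + c" a b] assms by simp
  finally show ?thesis
    by (metis a assms(2) antisym le_inf_iff scaleR_nonneg_nonneg)
qed

text \<open>A strictly positive constant permits rescaling into \<open>[-y, y]\<close>, where the
  uniform estimates are made.\<close>

lemma principal_ideal_pos_bound:
  assumes "x \<in> principal_ideal y" "0 \<le> y"
  obtains c where "c > 0" "\<bar>x\<bar> \<le> c *\<^sub>R y"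
proof -
  obtain c where c: "c \<ge> 0" "\<bar>x\<bar> \<le> c *\<^sub>R y"
    using assms(1) by (auto simp: principal_ideal_def)
  have "c *\<^sub>R y \<le> (c + 1) *\<^sub>R y" using assms(2) by (intro scaleR_right_mono) auto
  then have "\<bar>x\<bar> \<le> (c + 1) *\<^sub>R y" using c(2) by (rule order_trans[rotated])
  moreover have "c + 1 > 0" using c(1) by simp
  ultimately show thesis using that by blast
qed

lemma subspace_principal_ideal: "0 \<le> y \<Longrightarrow> subspace (principal_ideal y)"
  for y :: "'a::banach_lattice"
proof (rule subspaceI)
  show "0 \<in> principal_ideal y" unfolding principal_ideal_def by (auto intro!: exI[of _ 0])
next
  fix u v :: 'a assume "u \<in> principal_ideal y" "v \<in> principal_ideal y"
  then obtain c d where cd: "c \<ge> 0" "\<bar>u\<bar> \<le> c *\<^sub>R y" "d \<ge> 0" "\<bar>v\<bar> \<le> d *\<^sub>R y"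
    unfolding principal_ideal_def by auto
  have "\<bar>u + v\<bar> \<le> \<bar>u\<bar> + \<bar>v\<bar>" by (rule abs_triangle_ineq)
  also have "\<dots> \<le> c *\<^sub>R y + d *\<^sub>R y" using cd by (intro add_mono)
  finally have "\<bar>u + v\<bar> \<le> (c + d) *\<^sub>R y" by (simp add: scaleR_left_distrib)
  then show "u + v \<in> principal_ideal y"
    unfolding principal_ideal_def using cd(1,3) by (auto intro!: exI[of _ "c + d"])
next
  fix r and u :: 'a assume "u \<in> principal_ideal y"
  then obtain c where c: "c \<ge> 0" "\<bar>u\<bar> \<le> c *\<^sub>R y" unfolding principal_ideal_def by auto
  have "\<bar>r *\<^sub>R u\<bar> \<le> (\<bar>r\<bar> * c) *\<^sub>R y"
    using scaleR_left_mono[OF c(2), of "\<bar>r\<bar>"] by (simp add: abs_scaleR_lattice)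
  then show "r *\<^sub>R u \<in> principal_ideal y"
    unfolding principal_ideal_def using c(1) by (auto intro!: exI[of _ "\<bar>r\<bar> * c"])
qed

lemma abs_scaleR_inverse_le:
  fixes x y :: "'a::banach_lattice"
  assumes "c > 0" "\<bar>x\<bar> \<le> c *\<^sub>R y" shows "\<bar>(1 / c) *\<^sub>R x\<bar> \<le> y"
  using scaleR_left_mono[OF assms(2), of "1 / c"] assms(1) by (simp add: abs_scaleR_lattice)

text \<open>With \<open>L\<close> the set of lower bounds of \<open>D\<close>, the set of all \<open>d - l\<close> is directed
  downwards with infimum 0: if \<open>b\<close> is a lower bound then \<open>L\<close> is invariant under adding \<open>b\<close>, so
  all multiples of \<open>b\<close> are lower bounds as well.\<close>

lemma order_continuous_norm_directed:
  fixes D :: "'a::banach_lattice set"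
  assumes oc: "order_continuous_norm TYPE('a)"
    and ne: "D \<noteq> {}" and dir: "\<And>x y. x \<in> D \<Longrightarrow> y \<in> D \<Longrightarrow> \<exists>z\<in>D. z \<le> x \<and> z \<le> y"
    and nonneg: "\<And>x. x \<in> D \<Longrightarrow> l0 \<le> x"
  obtains d z where "\<And>n::nat. d n \<in> D" "d \<longlonglongrightarrow> z" "\<And>x. x \<in> D \<Longrightarrow> z \<le> x"
proof -
  define L where "L = {l. \<forall>x\<in>D. l \<le> x}"
  define D' where "D' = {d - l | d l. d \<in> D \<and> l \<in> L}"
  have l0: "l0 \<in> L" using nonneg by (auto simp: L_def)
  have ne': "D' \<noteq> {}" using ne l0 by (auto simp: D'_def)
  have dir': "\<exists>z\<in>D'. z \<le> x \<and> z \<le> y" if "x \<in> D'" "y \<in> D'" for x y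
  proof -
    obtain d1 l1 d2 l2 where 1: "x = d1 - l1" "y = d2 - l2" "d1 \<in> D" "d2 \<in> D" "l1 \<in> L" "l2 \<in> L"
      using \<open>x \<in> D'\<close> \<open>y \<in> D'\<close> unfolding D'_def by auto
    obtain d3 where 2: "d3 \<in> D" "d3 \<le> d1" "d3 \<le> d2" using dir[OF 1(3,4)] by blast
    have "sup l1 l2 \<in> L" using 1 by (auto simp: L_def)
    then have "d3 - sup l1 l2 \<in> D'" using 2(1) unfolding D'_def by auto
    moreover have "d3 - sup l1 l2 \<le> x" "d3 - sup l1 l2 \<le> y"
      using 1 2 by (auto intro!: diff_mono)
    ultimately show ?thesis by blast
  qed
  have nn': "0 \<le> x" if "x \<in> D'" for x using that by (auto simp: D'_def L_def)
  have inf': "b \<le> 0" if b: "\<forall>x\<in>D'. b \<le> x" for b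
  proof -
    have step: "l + b \<in> L" if "l \<in> L" for l
    proof -
      have "b \<le> x - l" if "x \<in> D" for x
        using b that \<open>l \<in> L\<close> unfolding D'_def by blast
      then show ?thesis by (simp add: L_def le_diff_eq add.commute)
    qed
    obtain d where d: "d \<in> D" using ne by blast
    have "l0 + real n *\<^sub>R b \<in> L" for n
    proof (induction n)
      case (Suc n)
      from step[OF this] show ?case by (simp add: algebra_simps)
    qed (use l0 in simp)
    then have "real n *\<^sub>R b \<le> d - l0" for n
      using d by (auto simp: L_def le_diff_eq add.commute)
    then show ?thesis by (rule le_zero_of_multiples_le)
  qed
  have lim: "((\<lambda>x. x) \<longlongrightarrow> 0) (INF x\<in>D'. principal {z\<in>D'. z \<le> x})"
  proof (rule oc[unfolded order_continuous_norm_def, rule_format], intro conjI)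
    show "\<forall>x\<in>D'. \<forall>y\<in>D'. \<exists>z\<in>D'. z \<le> x \<and> z \<le> y" by (intro ballI dir')
    show "\<forall>b. (\<forall>x\<in>D'. b \<le> x) \<longrightarrow> b \<le> 0" by (intro allI impI inf')
  qed (simp_all add: ne' nn')
  have small: "\<exists>x\<in>D'. norm x < e" if "e > 0" for e
  proof -
    have "eventually (\<lambda>x. norm x < e) (INF x\<in>D'. principal {z\<in>D'. z \<le> x})"
      using tendstoD[OF lim that] by simp
    moreover have "\<exists>x\<in>D'. {z\<in>D'. z \<le> x} \<subseteq> {z\<in>D'. z \<le> a} \<inter> {z\<in>D'. z \<le> b}"
      if "a \<in> D'" "b \<in> D'" for a b
      using dir'[OF that] by (auto intro: order_trans)
    ultimately have "\<exists>b\<in>D'. \<forall>z\<in>D'. z \<le> b \<longrightarrow> norm z < e"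
      using ne' by (subst (asm) eventually_INF_base) (auto simp: eventually_principal)
    then show ?thesis by blast
  qed
  have "\<exists>d l. d \<in> D \<and> l \<in> L \<and> norm (d - l) < inverse (real (Suc n))" for n
  proof -
    obtain x where "x \<in> D'" "norm x < inverse (real (Suc n))"
      using small[of "inverse (real (Suc n))"] by auto
    then show ?thesis unfolding D'_def by blast
  qed
  then obtain d l where dl: "\<And>n. d n \<in> D" "\<And>n. l n \<in> L"
      "\<And>n. norm (d n - l n) < inverse (real (Suc n))"
    by metis
  \<comment> \<open>A common minorant \<open>c\<close> of \<open>d n\<close> and \<open>d m\<close>
    in \<open>D\<close> lies above the lower bounds \<open>l n\<close> and \<open>l m\<close>, so
    \<open>d n - c\<close> and \<open>d m - c\<close> are controlled by the two gaps.\<close>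
  have dd: "norm (d n - d m) \<le> norm (d n - l n) + norm (d m - l m)" for n m
  proof -
    obtain c where c: "c \<in> D" "c \<le> d n" "c \<le> d m" using dir[OF dl(1) dl(1), of n m] by blast
    have "norm (d k - c) \<le> norm (d k - l k)" if "c \<le> d k" for k
      using that c dl(2)[of k] by (intro norm_mono_nonneg) (auto simp: L_def)
    then show ?thesis
      using norm_triangle_ineq4[of "d n - c" "d m - c"] c(2,3) by (smt (verit) add_diff_cancel diff_add_cancel diff_diff_eq2)
  qed
  have null: "(\<lambda>n. d n - l n) \<longlonglongrightarrow> 0"
  proof (rule Lim_null_comparison)
    show "\<forall>\<^sub>F n in sequentially. norm (d n - l n) \<le> inverse (real (Suc n))"
      using dl(3) by (intro always_eventually) (auto intro: less_imp_le)
  qed (rule LIMSEQ_inverse_real_of_nat)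
  have "Cauchy d"
  proof (rule metric_CauchyI)
    fix e :: real assume "e > 0"
    then obtain N where N: "\<And>n. n \<ge> N \<Longrightarrow> norm (d n - l n) < e / 2"
      using LIMSEQ_D[OF null, of "e/2"] by auto
    show "\<exists>M. \<forall>m\<ge>M. \<forall>n\<ge>M. dist (d m) (d n) < e"
    proof (intro exI[of _ N] allI impI)
      fix m n assume "m \<ge> N" "n \<ge> N"
      then show "dist (d m) (d n) < e"
        using N[of m] N[of n] dd[of m n] by (simp add: dist_norm)
    qed
  qed
  then obtain z where z: "d \<longlonglongrightarrow> z" by (metis Cauchy_convergent_iff convergent_def)
  \<comment> \<open>The lower bounds share the limit of \<open>d\<close>; this is what makes
    \<open>z\<close> a lower bound of all of \<open>D\<close>, hence its infimum.\<close>
  have "l \<longlonglongrightarrow> z" using tendsto_diff[OF z null] by simp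
  have "z \<le> x" if "x \<in> D" for x
    by (rule tendsto_le_lattice[OF \<open>l \<longlonglongrightarrow> z\<close> tendsto_const])
      (use that dl(2) in \<open>simp add: L_def\<close>)
  from that[OF dl(1) z this] show thesis .
qed

section \<open>The Hahn--Banach theorem for sublinear functionals\<close>

text \<open>Homogeneity is asked for as an inequality, which is the convenient form for infima of
  functionals; equality is recovered in \<open>sublinear_scaleR\<close>.\<close>

definition sublinear :: "('v::real_vector \<Rightarrow> real) \<Rightarrow> bool" where
  "sublinear g \<longleftrightarrow> (\<forall>x z. g (x + z) \<le> g x + g z) \<and> (\<forall>c\<ge>0. \<forall>x. g (c *\<^sub>R x) \<le> c * g x)"

lemma sublinear_add: "sublinear g \<Longrightarrow> g (x + z) \<le> g x + g z"
  by (simp add: sublinear_def)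

lemma sublinear_zero: "sublinear g \<Longrightarrow> g 0 = 0"
  using sublinear_add[of g 0 0] unfolding sublinear_def
  by (metis (no_types, lifting) add_0 antisym le_add_same_cancel1 mult_zero_left order_refl scaleR_zero_left)

lemma sublinear_scaleR:
  assumes g: "sublinear g" and c: "0 \<le> c" shows "g (c *\<^sub>R x) = c * g x"
proof (cases "c = 0")
  case True
  then show ?thesis using sublinear_zero[OF g] by simp
next
  case False
  have "g ((1 / c) *\<^sub>R (c *\<^sub>R x)) \<le> 1 / c * g (c *\<^sub>R x)"
    using g c unfolding sublinear_def by (metis divide_nonneg_nonneg zero_le_one)
  then have "c * g x \<le> g (c *\<^sub>R x)" using False c by (simp add: pos_le_divide_eq mult.commute)
  moreover have "g (c *\<^sub>R x) \<le> c * g x" using g c by (simp add: sublinear_def)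
  ultimately show ?thesis by simp
qed

lemma sublinear_minus: "sublinear g \<Longrightarrow> - g (- x) \<le> g x"
  using sublinear_add[of g x "- x"] sublinear_zero[of g] by simp

text \<open>The standard decreasing step behind Hahn--Banach. At \<open>x = - z\<close> the second
  bound reads \<open>h (- z) <= - g z\<close>, so \<open>h\<close> is properly smaller than
  \<open>g\<close> unless \<open>g\<close> is already odd at \<open>z\<close>.\<close>

lemma sublinear_translate:
  assumes g: "sublinear g"
  obtains h where "sublinear h" "\<And>x. h x \<le> g x" "\<And>x. h x \<le> g (x + z) - g z"
proof -
  define h where "h x = (INF c\<in>{0..}. g (x + c *\<^sub>R z) - c * g z)" for x
  have bdd: "bdd_below ((\<lambda>c. g (x + c *\<^sub>R z) - c * g z) ` {0..})" for x
  proof (rule bdd_belowI2)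
    fix c :: real assume "c \<in> {0..}"
    then show "- g (- x) \<le> g (x + c *\<^sub>R z) - c * g z"
      using sublinear_add[OF g, of "x + c *\<^sub>R z" "- x"] sublinear_scaleR[OF g, of c z] by simp
  qed
  have h_le: "h x \<le> g (x + c *\<^sub>R z) - c * g z" if "c \<ge> 0" for x c
    unfolding h_def by (rule cINF_lower[OF bdd]) (use that in simp)
  have h_greatest: "k \<le> h x" if "\<And>c. c \<ge> 0 \<Longrightarrow> k \<le> g (x + c *\<^sub>R z) - c * g z" for k x
    unfolding h_def by (rule cINF_greatest) (use that in auto)
  have "sublinear h" unfolding sublinear_def
  proof (intro conjI allI impI)
    fix u v
    have "h (u + v) - (g (u + c *\<^sub>R z) - c * g z) \<le> g (v + d *\<^sub>R z) - d * g z"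
      if "c \<ge> 0" "d \<ge> 0" for c d
      using h_le[of "c + d" "u + v"] that sublinear_add[OF g, of "u + c *\<^sub>R z" "v + d *\<^sub>R z"]
      by (simp add: algebra_simps)
    then have "h (u + v) - (g (u + c *\<^sub>R z) - c * g z) \<le> h v" if "c \<ge> 0" for c
      using that by (intro h_greatest) auto
    then have "h (u + v) - h v \<le> h u"
      by (intro h_greatest) (simp add: algebra_simps)
    then show "h (u + v) \<le> h u + h v" by simp
  next
    fix c :: real and x assume c: "c \<ge> 0"
    show "h (c *\<^sub>R x) \<le> c * h x"
    proof (cases "c = 0")
      case True
      then show ?thesis using h_le[of 0 0] sublinear_zero[OF g] by simp
    next
      case False
      have "h (c *\<^sub>R x) / c \<le> h x"
      proof (rule h_greatest)
        fix d :: real assume d: "d \<ge> 0"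
        have "h (c *\<^sub>R x) \<le> g (c *\<^sub>R (x + d *\<^sub>R z)) - c * d * g z"
          using h_le[of "c * d" "c *\<^sub>R x"] c d by (simp add: scaleR_right_distrib)
        also have "\<dots> = c * (g (x + d *\<^sub>R z) - d * g z)"
          unfolding sublinear_scaleR[OF g c] by (simp add: algebra_simps)
        finally show "h (c *\<^sub>R x) / c \<le> g (x + d *\<^sub>R z) - d * g z"
          using False c by (simp add: pos_divide_le_eq mult.commute)
      qed
      then show ?thesis using False c by (simp add: pos_divide_le_eq mult.commute)
    qed
  qed
  moreover have "h x \<le> g x" for x using h_le[of 0 x] by simp
  moreover have "h x \<le> g (x + z) - g z" for x using h_le[of 1 x] by simp
  ultimately show thesis using that by blast
qed

text \<open>Zorn's lemma: the pointwise infimum of a chain is finite because of the bound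
  \<open>- p (- x)\<close>, and subadditive because of any two members the smaller one serves both
  summands.\<close>

lemma ex_minimal_sublinear:
  assumes p: "sublinear p"
  obtains m where "sublinear m" "\<And>x. m x \<le> p x"
    "\<And>h. sublinear h \<Longrightarrow> (\<And>x. h x \<le> m x) \<Longrightarrow> h = m"
proof -
  define A where "A = {g. sublinear g \<and> g \<le> p}"
  \<comment> \<open>The order is reversed, as Zorn's lemma supplies maximal elements.\<close>
  define P where "P = (\<lambda>a b. b \<le> (a :: 'a \<Rightarrow> real))"
  have "\<exists>m\<in>A. \<forall>a\<in>A. P m a \<longrightarrow> a = m"
  proof (rule predicate_Zorn)
    show "partial_order_on A (relation_of P A)"
      unfolding P_def by (rule partial_order_on_relation_ofI) auto
    fix C assume "C \<in> Chains (relation_of P A)"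
    then have CA: "C \<subseteq> A" and tot: "\<And>a b. a \<in> C \<Longrightarrow> b \<in> C \<Longrightarrow> a \<le> b \<or> b \<le> a"
      unfolding Chains_def relation_of_def P_def by auto
    show "\<exists>u\<in>A. \<forall>a\<in>C. P a u"
    proof (cases "C = {}")
      case True
      then show ?thesis using p by (intro bexI[of _ p]) (auto simp: A_def)
    next
      case False
      define u where "u x = (INF g\<in>C. g x)" for x
      have C: "sublinear g" "g x \<le> p x" if "g \<in> C" for g x
        using that CA by (auto simp: A_def le_fun_def)
      have bdd: "bdd_below ((\<lambda>g. g x) ` C)" for x
      proof (rule bdd_belowI2)
        fix g assume "g \<in> C"
        then show "- p (- x) \<le> g x" using sublinear_minus[OF C(1), of g x] C(2)[of g "- x"] by simp
      qed
      have u_le: "u x \<le> g x" if "g \<in> C" for g x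
        unfolding u_def by (rule cINF_lower[OF bdd that])
      have u_greatest: "k \<le> u x" if "\<And>g. g \<in> C \<Longrightarrow> k \<le> g x" for k x
        unfolding u_def by (rule cINF_greatest[OF False that])
      have "sublinear u" unfolding sublinear_def
      proof (intro conjI allI impI)
        fix x z
        have "u (x + z) - g x \<le> h z" if gh: "g \<in> C" "h \<in> C" for g h
        proof -
          have "\<exists>k\<in>C. k \<le> g \<and> k \<le> h" using tot[OF gh] gh by auto
          then obtain k where k: "k \<in> C" "k x \<le> g x" "k z \<le> h z" by (auto simp: le_fun_def)
          then show ?thesis using u_le[of k "x + z"] sublinear_add[OF C(1), of k x z] by simp
        qed
        then have "u (x + z) - g x \<le> u z" if "g \<in> C" for g
          using that by (intro u_greatest) auto
        then have "u (x + z) - u z \<le> u x" by (intro u_greatest) (simp add: algebra_simps)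
        then show "u (x + z) \<le> u x + u z" by simp
      next
        fix c :: real and x assume c: "c \<ge> 0"
        show "u (c *\<^sub>R x) \<le> c * u x"
        proof (cases "c = 0")
          case True
          obtain g where "g \<in> C" using False by blast
          then show ?thesis using True u_le[of g 0] sublinear_zero[OF C(1), of g] by simp
        next
          case c': False
          have "u (c *\<^sub>R x) / c \<le> u x"
          proof (rule u_greatest)
            fix g assume "g \<in> C"
            then show "u (c *\<^sub>R x) / c \<le> g x"
              using u_le[of g "c *\<^sub>R x"] sublinear_scaleR[OF C(1) c, of g x] c c'
              by (simp add: pos_divide_le_eq mult.commute)
          qed
          then show ?thesis using c c' by (simp add: pos_divide_le_eq mult.commute)
        qed
      qed
      moreover have "u \<le> p"
        using False u_le C(2) by (metis equals0I le_funI order_trans)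
      ultimately show ?thesis
        using u_le by (intro bexI[of _ u]) (auto simp: A_def P_def le_fun_def)
    qed
  qed
  then obtain m where m: "m \<in> A" "\<And>a. a \<in> A \<Longrightarrow> a \<le> m \<Longrightarrow> a = m" by (auto simp: P_def)
  have "h = m" if "sublinear h" "\<And>x. h x \<le> m x" for h
  proof (rule m(2))
    show "h \<le> m" using that(2) by (rule le_funI)
    then show "h \<in> A" using m(1) that(1) by (auto simp: A_def)
  qed
  then show thesis using that m(1) by (auto simp: A_def le_fun_def)
qed

text \<open>A minimal sublinear functional coincides with each of its decreased versions from
  \<open>sublinear_translate\<close>, and this equality is additivity. The preliminary step in
  direction \<open>w\<close> gives \<open>q (- w) <= - p w\<close>, which fixes the value at
  \<open>w\<close>.\<close>

lemma Hahn_Banach_sublinear: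
  assumes p: "sublinear p"
  obtains f where "linear f" "\<And>x. f x \<le> p x" "f w = p w"
proof -
  obtain q where q: "sublinear q" "\<And>x. q x \<le> p x" "\<And>x. q x \<le> p (x + w) - p w"
    using sublinear_translate[OF p] by blast
  obtain f where f: "sublinear f" "\<And>x. f x \<le> q x"
    "\<And>h. sublinear h \<Longrightarrow> (\<And>x. h x \<le> f x) \<Longrightarrow> h = f"
    using ex_minimal_sublinear[OF q(1)] by blast
  have add: "f (x + z) = f x + f z" for x z
  proof -
    obtain h where h: "sublinear h" "\<And>x. h x \<le> f x" "\<And>x. h x \<le> f (x + z) - f z"
      using sublinear_translate[OF f(1)] by blast
    have "f x \<le> f (x + z) - f z" using f(3)[OF h(1,2)] h(3)[of x] by simp
    then show ?thesis using sublinear_add[OF f(1), of x z] by simp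
  qed
  have neg: "f (- x) = - f x" for x using add[of x "- x"] sublinear_zero[OF f(1)] by simp
  have "f (c *\<^sub>R x) = c *\<^sub>R f x" for c x
    using sublinear_scaleR[OF f(1), of c x] sublinear_scaleR[OF f(1), of "- c" x] neg[of "c *\<^sub>R x"]
    by (cases "c \<ge> 0") simp_all
  with add have "linear f" by (intro linearI)
  moreover have fp: "f x \<le> p x" for x using f(2) q(2) order_trans by blast
  moreover have "f w = p w"
    using f(2)[of "- w"] q(3)[of "- w"] neg[of w] sublinear_zero[OF p] fp[of w] by simp
  ultimately show thesis using that by blast
qed

section \<open>Atoms in sublattices with compact order intervals\<close>

lemma pprt_add_le: "pprt (x + z) \<le> pprt x + pprt z" for x z :: "'a::lattice_ab_group_add_abs"
proof -
  have "x + z \<le> pprt x + pprt z" unfolding pprt_def by (intro add_mono sup_ge1)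
  moreover have "0 \<le> pprt x + pprt z" by (intro add_nonneg_nonneg zero_le_pprt)
  ultimately show ?thesis unfolding pprt_def[of "x + z"] by (rule sup_least)
qed

lemma pprt_scaleR: "0 \<le> c \<Longrightarrow> pprt (c *\<^sub>R x) = c *\<^sub>R pprt x" for x :: "'a::banach_lattice"
  using scaleR_inf[of c "- x" 0] by (simp add: pprt_def sup_eq_neg_inf[of _ 0])

lemma sublinear_norm_pprt: "sublinear (\<lambda>x::'a::banach_lattice. norm (pprt x))"
  unfolding sublinear_def
proof (intro conjI allI impI)
  fix x z :: 'a
  have "norm (pprt (x + z)) \<le> norm (pprt x + pprt z)"
    by (rule norm_mono_nonneg[OF zero_le_pprt pprt_add_le])
  also have "\<dots> \<le> norm (pprt x) + norm (pprt z)" by (rule norm_triangle_ineq)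
  finally show "norm (pprt (x + z)) \<le> norm (pprt x) + norm (pprt z)" .
qed (simp add: pprt_scaleR)

text \<open>The dominating functional is \<open>norm (pprt x)\<close> instead of the norm: it
  vanishes on negative vectors, so a linear functional below it is positive automatically.\<close>

lemma ex_positive_functional:
  fixes w :: "'a::banach_lattice"
  assumes "0 \<le> w"
  obtains f :: "'a \<Rightarrow> real" where "linear f" "\<And>x. 0 \<le> x \<Longrightarrow> 0 \<le> f x" "\<And>x. \<bar>f x\<bar> \<le> norm x"
    "f w = norm w"
proof -
  obtain f :: "'a \<Rightarrow> real" where f: "linear f" "\<And>x. f x \<le> norm (pprt x)" "f w = norm (pprt w)"
    using Hahn_Banach_sublinear[OF sublinear_norm_pprt, of w] by blast
  have "0 \<le> f x" if "0 \<le> x" for x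
    using f(2)[of "- x"] that by (simp add: linear_neg[OF f(1)])
  moreover have le: "f x \<le> norm x" for x
    using f(2)[of x] norm_pprt_le[of x] by linarith
  have "\<bar>f x\<bar> \<le> norm x" for x
    using le[of x] le[of "- x"] by (simp add: linear_neg[OF f(1)] abs_le_iff)
  ultimately show thesis using that f(1,3) assms by simp
qed

text \<open>The sum of the two infima expands to the infimum of four sums, each of which dominates
  the left side.\<close>

lemma inf_add_le:
  fixes a b c :: "'a::lattice_ab_group_add_abs"
  assumes "0 \<le> a" "0 \<le> b" "0 \<le> c" shows "inf a (b + c) \<le> inf a b + inf a c"
proof -
  have "inf a (b + c) \<le> a + a" "inf a (b + c) \<le> a + c" "inf a (b + c) \<le> b + a"
    using assms by (auto intro: order_trans[OF inf_le1] add_increasing add_increasing2)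
  then have "inf a (b + c) \<le> inf (inf (a + a) (a + c)) (inf (b + a) (b + c))"
    by (intro le_infI) auto
  also have "\<dots> = inf a b + inf a c"
    by (simp add: add_inf_distrib_left add_inf_distrib_right)
      (metis inf_assoc inf_left_commute)
  finally show ?thesis .
qed

text \<open>Comes from \<open>e + x = inf e x + sup e x\<close> and the fact that supremum and
  infimum differ by at most \<open>\<bar>e - x\<bar>\<close>. It serves to bound distances from
  below when \<open>inf e x\<close> is small.\<close>

lemma add_le_inf_abs_diff: "e + x \<le> 2 *\<^sub>R inf e x + \<bar>e - x\<bar>" for e x :: "'a::banach_lattice"
proof -
  have *: "a \<le> b + \<bar>a - b\<bar>" for a b :: 'a
    using add_left_mono[OF abs_ge_self[of "a - b"], of b] by simp
  have "e \<le> inf (e + \<bar>e - x\<bar>) (x + \<bar>e - x\<bar>)" using * by (intro le_infI) simp_all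
  moreover have "x \<le> inf (e + \<bar>e - x\<bar>) (x + \<bar>e - x\<bar>)"
    using *[of x e] by (intro le_infI) (simp_all add: abs_minus_commute)
  ultimately have "sup e x \<le> inf e x + \<bar>e - x\<bar>"
    unfolding add_inf_distrib_right by (rule sup_least)
  then show ?thesis
    using add_eq_inf_sup[of e x] add_right_mono[of "sup e x" "inf e x + \<bar>e - x\<bar>" "inf e x"]
    by (simp add: scaleR_2 algebra_simps)
qed

text \<open>The sets \<open>{x. x \<le> a}\<close> are closed, so the finite intersection property
  gives every chain a lower bound in \<open>S\<close>, and Zorn's lemma applies.\<close>

lemma compact_minimal:
  fixes S :: "'a::banach_lattice set"
  assumes S: "compact S" "S \<noteq> {}"
  obtains m where "m \<in> S" "\<And>a. a \<in> S \<Longrightarrow> a \<le> m \<Longrightarrow> a = m"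
proof -
  define P where "P = (\<lambda>a b. b \<le> (a :: 'a))"
  have "\<exists>m\<in>S. \<forall>a\<in>S. P m a \<longrightarrow> a = m"
  proof (rule predicate_Zorn)
    show "partial_order_on S (relation_of P S)"
      unfolding P_def by (rule partial_order_on_relation_ofI) auto
    fix C assume "C \<in> Chains (relation_of P S)"
    then have CS: "C \<subseteq> S" and tot: "\<And>a b. a \<in> C \<Longrightarrow> b \<in> C \<Longrightarrow> a \<le> b \<or> b \<le> a"
      unfolding Chains_def relation_of_def P_def by auto
    have least: "\<exists>m\<in>S. \<forall>a\<in>K. m \<le> a \<and> (K \<noteq> {} \<longrightarrow> m \<in> C)" if "finite K" "K \<subseteq> C" for K
      using that
    proof (induction K)
      case empty
      then show ?case using S(2) by blast
    next
      case (insert k K)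
      then obtain m where m: "m \<in> S" "\<forall>a\<in>K. m \<le> a \<and> (K \<noteq> {} \<longrightarrow> m \<in> C)" by auto
      show ?case
      proof (cases "K = {}")
        case True
        then show ?thesis using insert.prems CS by (intro bexI[of _ k]) auto
      next
        case False
        then have "m \<in> C" using m(2) by blast
        moreover have "k \<in> C" using insert.prems by simp
        ultimately consider "m \<le> k" | "k \<le> m" using tot by blast
        then show ?thesis
        proof cases
          case 1
          then show ?thesis using m \<open>m \<in> C\<close> by (intro bexI[of _ m]) auto
        next
          case 2
          then show ?thesis using m(2) \<open>k \<in> C\<close> CS by (intro bexI[of _ k]) (auto intro: order_trans)
        qed
      qed
    qed
    have "S \<inter> (\<Inter>a\<in>C. {x. x \<le> a}) \<noteq> {}"
    proof (rule compact_imp_fip_image[OF S(1)])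
      show "closed {x. x \<le> a}" for a :: 'a by (rule closed_atMost_lattice)
      show "S \<inter> (\<Inter>a\<in>K. {x. x \<le> a}) \<noteq> {}" if "finite K" "K \<subseteq> C" for K
        using least[OF that] by auto
    qed
    then show "\<exists>u\<in>S. \<forall>a\<in>C. P a u" by (auto simp: P_def)
  qed
  then show thesis using that by (auto simp: P_def)
qed

locale vector_sublattice =
  fixes L :: "'a::banach_lattice set"
  assumes subspace: "subspace L" and abs_mem: "x \<in> L \<Longrightarrow> \<bar>x\<bar> \<in> L"
begin

text \<open>The notion is relative to \<open>L\<close>: only minorants in \<open>L\<close> are
  tested, so an atom here need not be one of the surrounding lattice.\<close>

definition atom :: "'a \<Rightarrow> bool" where
  "atom a \<longleftrightarrow> a \<in> L \<and> a > 0 \<and> (\<forall>x\<in>L. 0 \<le> x \<and> x \<le> a \<longrightarrow> (\<exists>c. x = c *\<^sub>R a))"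

lemmas mem_add = subspace_add[OF subspace] and mem_diff = subspace_diff[OF subspace]
  and mem_scaleR = subspace_scale[OF subspace] and mem_zero = subspace_0[OF subspace]

lemma pprt_mem: assumes "x \<in> L" shows "pprt x \<in> L"
proof -
  have "\<bar>x\<bar> + x = (pprt x - nprt x) + (pprt x + nprt x)"
    using abs_prts[of x] prts[of x] by (rule arg_cong2)
  then have "\<bar>x\<bar> + x = 2 *\<^sub>R pprt x" by (simp add: scaleR_2)
  then have "pprt x = (1 / 2) *\<^sub>R (\<bar>x\<bar> + x)" by simp
  then show ?thesis using mem_scaleR[OF mem_add[OF abs_mem[OF assms] assms]] by simp
qed

lemma inf_mem: assumes "a \<in> L" "b \<in> L" shows "inf a b \<in> L"
proof -
  have "inf a b = a - pprt (a - b)"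
    unfolding pprt_def diff_sup_eq_inf by (simp add: inf_commute add_inf_distrib_left)
  then show ?thesis using mem_diff[OF assms(1) pprt_mem[OF mem_diff[OF assms]]] by simp
qed

end

section \<open>Components of a vector with compact order interval\<close>

locale compact_interval = vector_sublattice +
  fixes w assumes w_mem: "w \<in> L" and w_nonneg: "0 \<le> w" and compact: "compact {x\<in>L. \<bar>x\<bar> \<le> w}"
begin

text \<open>Abstract indicator functions: \<open>e\<close> and \<open>w - e\<close> are disjoint
  complementary parts of \<open>w\<close>, and these parts behave like a Boolean algebra of
  sets.\<close>

definition components :: "'a set" where
  "components = {e\<in>L. inf e (w - e) = 0}"

lemma component_mem: "e \<in> components \<Longrightarrow> e \<in> L"
  by (simp add: components_def)

lemma component_nonneg: "e \<in> components \<Longrightarrow> 0 \<le> e"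
  unfolding components_def mem_Collect_eq by (metis inf_le1)

lemma component_le: assumes "e \<in> components" shows "e \<le> w"
proof -
  have "0 \<le> w - e" using assms unfolding components_def mem_Collect_eq by (metis inf_le2)
  then show ?thesis by simp
qed

lemma componentI:
  assumes "e \<in> L" "0 \<le> e" "e \<le> w" "inf e (w - e) \<le> 0" shows "e \<in> components"
  unfolding components_def using assms by (simp add: antisym)

lemma w_component: "w \<in> components"
  using w_mem w_nonneg by (intro componentI) simp_all

lemma zero_component: "0 \<in> components"
  using w_nonneg mem_zero by (intro componentI) simp_all

lemma component_diff:
  assumes e: "e \<in> components" and x: "x \<in> components" and le: "x \<le> e"
  shows "e - x \<in> components"
proof (rule componentI)
  show "e - x \<in> L" using mem_diff e x component_mem by blast
  show "0 \<le> e - x" using le by simp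
  have "e - x \<le> e" using component_nonneg[OF x] by simp
  then show "e - x \<le> w" using component_le[OF e] by (rule order_trans)
  have "inf (e - x) (w - (e - x)) = inf (e - x) ((w - e) + x)" by (simp add: algebra_simps)
  also have "\<dots> \<le> inf (e - x) (w - e) + inf (e - x) x"
    using le component_le[OF e] component_nonneg[OF x] by (intro inf_add_le) simp_all
  also have "\<dots> \<le> inf e (w - e) + inf (w - x) x"
    using component_nonneg[OF x] component_le[OF e]
    by (intro add_mono inf_mono order_refl diff_right_mono) simp_all
  also have "\<dots> = 0" using e x by (simp add: components_def inf_commute)
  finally show "inf (e - x) (w - (e - x)) \<le> 0" .
qed

lemma component_add:
  assumes e: "e \<in> components" and x: "x \<in> components" and le: "e + x \<le> w"
  shows "e + x \<in> components"
proof -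
  have "w - e \<in> components" by (rule component_diff[OF w_component e component_le[OF e]])
  moreover have "x \<le> w - e" using le by (simp add: le_diff_eq add.commute)
  ultimately have "w - e - x \<in> components" using x component_diff by blast
  then have "w - (w - e - x) \<in> components"
    using component_diff[OF w_component] component_le by blast
  then show ?thesis by (simp add: algebra_simps)
qed

lemma component_inf:
  assumes e: "e \<in> components" and x: "x \<in> components" shows "inf e x \<in> components"
proof (rule componentI)
  note nn = component_nonneg[OF e] component_nonneg[OF x] component_le[OF e] component_le[OF x]
  show "inf e x \<in> L" using inf_mem e x component_mem by blast
  show "0 \<le> inf e x" using nn by simp
  show "inf e x \<le> w" using nn by (simp add: le_infI1)
  have "w - inf e x = sup (w - e) (w - x)"
    unfolding diff_inf_eq_sup by (simp add: add_sup_distrib_left)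
  also have "\<dots> \<le> (w - e) + (w - x)"
    using nn by (intro sup_least) simp_all
  finally have "inf (inf e x) (w - inf e x) \<le> inf (inf e x) ((w - e) + (w - x))"
    by (rule inf_mono[OF order_refl])
  also have "\<dots> \<le> inf (inf e x) (w - e) + inf (inf e x) (w - x)"
    using nn by (intro inf_add_le) simp_all
  also have "\<dots> \<le> inf e (w - e) + inf x (w - x)"
    by (intro add_mono inf_mono inf_le1 inf_le2 order_refl)
  also have "\<dots> = 0" using e x by (simp add: components_def)
  finally show "inf (inf e x) (w - inf e x) \<le> 0" .
qed

text \<open>The bound \<open>e + u \<le> w\<close> puts \<open>u\<close> below \<open>w - e\<close>
  and makes \<open>e\<close> and \<open>u\<close> disjoint; so their parts below \<open>x\<close>
  are disjoint too, and their sum is their supremum, which is below \<open>x\<close>.\<close>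

lemma component_inf_add:
  assumes e: "e \<in> components" and u: "u \<in> components" and x: "x \<in> components" and le: "e + u \<le> w"
  shows "inf (e + u) x = inf e x + inf u x"
proof (rule antisym)
  note nn = component_nonneg[OF e] component_nonneg[OF x] component_nonneg[OF u]
  show "inf (e + u) x \<le> inf e x + inf u x"
    using inf_add_le[of x e u] nn by (simp add: inf_commute)
  have "inf (inf e x) (inf u x) \<le> inf e u" by (intro inf_mono inf_le1)
  also have "\<dots> \<le> inf e (w - e)"
    by (rule inf_mono[OF order_refl]) (use le in \<open>simp add: le_diff_eq add.commute\<close>)
  also have "\<dots> = 0" using e by (simp add: components_def)
  finally have "inf (inf e x) (inf u x) \<le> 0" .
  then have "inf e x + inf u x \<le> sup (inf e x) (inf u x)"
    using add_eq_inf_sup[of "inf e x" "inf u x"] by simp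
  also have "\<dots> \<le> x" by simp
  finally have "inf e x + inf u x \<le> x" .
  moreover have "inf e x + inf u x \<le> e + u" by (intro add_mono inf_le1)
  ultimately show "inf e x + inf u x \<le> inf (e + u) x" by simp
qed

lemma compact_components: "compact components"
proof -
  have "closed {e. inf e (w - e) = 0}"
    unfolding closed_sequential_limits
  proof (intro allI impI, elim conjE)
    fix X l assume X: "\<forall>n. X n \<in> {e. inf e (w - e) = 0}" and lim: "X \<longlonglongrightarrow> l"
    have "(\<lambda>n. inf (X n) (w - X n)) \<longlonglongrightarrow> inf l (w - l)"
      by (intro tendsto_inf_lattice tendsto_diff tendsto_const lim)
    then show "l \<in> {e. inf e (w - e) = 0}" using X by (simp add: LIMSEQ_const_iff)
  qed
  then have "compact ({x\<in>L. \<bar>x\<bar> \<le> w} \<inter> {e. inf e (w - e) = 0})"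
    by (rule compact_Int_closed[OF compact])
  moreover have "{x\<in>L. \<bar>x\<bar> \<le> w} \<inter> {e. inf e (w - e) = 0} = components"
    using component_nonneg component_le by (auto simp: components_def)
  ultimately show ?thesis by simp
qed

text \<open>The component is the projection of \<open>v\<close> onto the band generated by \<open>p\<close>; compactness replaces
  order completeness for its existence.\<close>

lemma component_split:
  assumes v: "v \<in> components" and pn: "p \<in> L" "0 \<le> p" "p \<le> v" "p \<noteq> 0" "0 \<le> n" "n \<le> v" "n \<noteq> 0"
    "inf p n = 0"
  shows "\<exists>e\<in>components. e \<le> v \<and> e \<noteq> 0 \<and> e \<noteq> v"
proof -
  define u where "u k = inf v (real k *\<^sub>R p)" for k
  note v' = component_nonneg[OF v] component_le[OF v] component_mem[OF v]
  have u_nn: "0 \<le> u k" for k using v' pn by (simp add: u_def scaleR_nonneg_nonneg)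
  have u_le: "u k \<le> v" for k by (simp add: u_def)
  have u_L: "u k \<in> L" for k unfolding u_def using v' pn by (intro inf_mem mem_scaleR)
  have u_mono: "u j \<le> u k" if "j \<le> k" for j k
    unfolding u_def using that pn by (intro inf_mono scaleR_right_mono) auto
  have "u k \<in> {x\<in>L. \<bar>x\<bar> \<le> w}" for k
    using u_nn[of k] u_L[of k] order_trans[OF u_le[of k] v'(2)] by simp
  then obtain e r where e: "e \<in> {x\<in>L. \<bar>x\<bar> \<le> w}" "strict_mono r" "(u \<circ> r) \<longlonglongrightarrow> e"
    using compact[unfolded compact_def] by blast
  have lim: "(\<lambda>k. u (r k)) \<longlonglongrightarrow> e" using e(3) by (simp add: o_def)
  have u_le_e: "u k \<le> e" for k
  proof (rule tendsto_le_lattice[OF tendsto_const])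
    show "(\<lambda>j. u (r (j + k))) \<longlonglongrightarrow> e" by (rule LIMSEQ_ignore_initial_segment[OF lim])
    show "u k \<le> u (r (j + k))" for j
      using seq_suble[OF e(2), of "j + k"] by (intro u_mono) simp
  qed
  have e_nn: "0 \<le> e" using u_nn u_le_e order_trans by blast
  have e_le: "e \<le> v" by (rule tendsto_le_lattice[OF lim tendsto_const]) (rule u_le)
  \<comment> \<open>This infimum added to \<open>u k\<close> stays below \<open>u (Suc k)\<close>
    and hence below \<open>e\<close>; in the limit it can be added to \<open>e\<close> itself
    without leaving \<open>e\<close>, so it is zero.\<close>
  have "inf (v - e) p = 0"
  proof -
    have "u k + inf (v - e) p \<le> e" for k
    proof -
      have "u k + inf (v - e) p \<le> u (Suc k)"
        unfolding u_def[of "Suc k"]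
      proof (rule le_infI)
        have "u k + inf (v - e) p \<le> e + (v - e)" by (intro add_mono u_le_e inf_le1)
        then show "u k + inf (v - e) p \<le> v" by simp
        have "u k + inf (v - e) p \<le> real k *\<^sub>R p + p"
          unfolding u_def by (intro add_mono inf_le2)
        then show "u k + inf (v - e) p \<le> real (Suc k) *\<^sub>R p" by (simp add: algebra_simps)
      qed
      then show ?thesis using u_le_e[of "Suc k"] by (rule order_trans)
    qed
    then have "e + inf (v - e) p \<le> e"
      by (intro tendsto_le_lattice[OF tendsto_add[OF lim tendsto_const] tendsto_const])
    then have "inf (v - e) p \<le> 0" by simp
    then show ?thesis using e_le pn(2) by (simp add: antisym)
  qed
  then have pve: "inf p (v - e) = 0" by (simp add: inf_commute)
  have disj: "inf e z = 0" if z: "inf p z = 0" for z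
  proof -
    have z_nn: "0 \<le> z" using z by (metis inf_le2)
    have "inf (u k) z = 0" for k
    proof (rule antisym)
      have "inf (u k) z \<le> inf (real k *\<^sub>R p) z" unfolding u_def by (intro inf_mono inf_le2 order_refl)
      also have "\<dots> = 0" by (rule inf_zero_scaleR[OF z]) simp
      finally show "inf (u k) z \<le> 0" .
    qed (use u_nn z_nn in simp)
    then show ?thesis using tendsto_inf_left[OF lim, of z] by (simp add: LIMSEQ_const_iff)
  qed
  have "e \<in> components"
  proof (rule componentI)
    show "e \<in> L" using e(1) by simp
    show "0 \<le> e" by (rule e_nn)
    show "e \<le> w" using e_le v'(2) by (rule order_trans)
    have "inf e (w - e) = inf e ((v - e) + (w - v))" by simp
    also have "\<dots> \<le> inf e (v - e) + inf e (w - v)"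
      using e_nn e_le v' by (intro inf_add_le) simp_all
    also have "inf e (v - e) = 0" by (rule disj[OF pve])
    also have "inf e (w - v) \<le> inf v (w - v)" by (intro inf_mono e_le order_refl)
    also have "inf v (w - v) = 0" using v by (simp add: components_def)
    finally show "inf e (w - e) \<le> 0" by simp
  qed
  moreover have "e \<noteq> 0"
  proof
    assume "e = 0"
    then have "u 1 \<le> 0" using u_le_e[of 1] by simp
    then have "p \<le> 0" using pn(3) by (simp add: u_def inf_absorb2)
    then show False using pn(2,4) by simp
  qed
  moreover have "e \<noteq> v"
  proof
    assume "e = v"
    then have "inf v n = 0" using disj[OF pn(8)] by simp
    then show False using pn(6,7) by (simp add: inf_absorb2)
  qed
  ultimately show ?thesis using e_le by blast
qed

text \<open>If \<open>x\<close> is no multiple of \<open>v\<close>, the closed sets of all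
  \<open>c\<close> with \<open>c v <= x\<close> and with \<open>x <= c v\<close> are disjoint.
  Connectedness of the unit interval then gives a \<open>c\<close> for which \<open>x\<close> and
  \<open>c v\<close> are incomparable, and the positive parts of their two differences are non-zero
  and disjoint.\<close>

lemma component_split_no_atom:
  assumes v: "v \<in> components" "v \<noteq> 0" "\<not> atom v"
  shows "\<exists>e\<in>components. e \<le> v \<and> e \<noteq> 0 \<and> e \<noteq> v"
proof -
  note v' = component_nonneg[OF v(1)] component_le[OF v(1)] component_mem[OF v(1)]
  have "v > 0" using v' v(2) by (simp add: less_le)
  then obtain x where x: "x \<in> L" "0 \<le> x" "x \<le> v" "\<And>c. x \<noteq> c *\<^sub>R v"
    using v(3) v' unfolding atom_def by blast
  define A B where "A = {c. c *\<^sub>R v \<le> x}" and "B = {c. x \<le> c *\<^sub>R v}"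
  have AB: "A \<inter> B = {}" using x(4) antisym unfolding A_def B_def by blast
  have "continuous_on UNIV (\<lambda>c::real. c *\<^sub>R v)" by (intro continuous_intros)
  then have "closed A" "closed B" unfolding A_def B_def
    using closed_vimage[OF closed_atMost_lattice[of x], of "\<lambda>c. c *\<^sub>R v"]
      closed_vimage[OF closed_atLeast_lattice[of x], of "\<lambda>c. c *\<^sub>R v"]
    by (simp_all add: vimage_def)
  moreover have "0 \<in> A" "1 \<in> B" using x by (simp_all add: A_def B_def)
  moreover have "0 \<in> {0..1::real}" "1 \<in> {0..1::real}" by simp_all
  ultimately have "\<not> {0..1} \<subseteq> A \<union> B"
    using connected_Icc[of "0::real" 1, unfolded connected_closed] AB by blast
  then obtain c where "c \<in> {0..1}" "c \<notin> A" "c \<notin> B" by blast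
  then have c: "0 \<le> c" "c \<le> 1" "\<not> c *\<^sub>R v \<le> x" "\<not> x \<le> c *\<^sub>R v"
    by (simp_all add: A_def B_def)
  define p n where "p = pprt (x - c *\<^sub>R v)" and "n = pprt (c *\<^sub>R v - x)"
  have cv: "0 \<le> c *\<^sub>R v" "c *\<^sub>R v \<le> v"
    using c v' scaleR_right_mono[of c 1 v] by (simp_all add: scaleR_nonneg_nonneg)
  show ?thesis
  proof (rule component_split[OF v(1)])
    show "p \<in> L" unfolding p_def using x v' by (intro pprt_mem mem_diff mem_scaleR)
    show "0 \<le> p" "0 \<le> n" by (simp_all add: p_def n_def)
    have "x - c *\<^sub>R v \<le> x" using cv by simp
    then have "x - c *\<^sub>R v \<le> v" using x(3) by (rule order_trans)
    then show "p \<le> v" unfolding p_def pprt_def using v' by simp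
    have "c *\<^sub>R v - x \<le> c *\<^sub>R v" using x by simp
    then have "c *\<^sub>R v - x \<le> v" using cv(2) by (rule order_trans)
    then show "n \<le> v" unfolding n_def pprt_def using v' by simp
    show "p \<noteq> 0" "n \<noteq> 0"
      using c(3,4) le_zero_iff_zero_pprt[of "x - c *\<^sub>R v"] le_zero_iff_zero_pprt[of "c *\<^sub>R v - x"]
      by (simp_all add: p_def n_def)
    have "inf p n = inf (x - c *\<^sub>R v) 0 + pprt (c *\<^sub>R v - x)"
    proof -
      have "p = (x - c *\<^sub>R v) + n"
        using prts[of "x - c *\<^sub>R v"] pprt_neg[of "x - c *\<^sub>R v"] by (simp add: p_def n_def algebra_simps)
      then have "inf p n = inf ((x - c *\<^sub>R v) + n) (0 + n)" by simp
      then show ?thesis by (simp only: add_inf_distrib_right n_def)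
    qed
    also have "\<dots> = 0"
      using pprt_neg[of "x - c *\<^sub>R v"] by (simp add: nprt_def)
    finally show "inf p n = 0" .
  qed
qed

section \<open>Intervals without atoms, measured by a positive functional\<close>

context
  fixes f :: "'a \<Rightarrow> real"
  assumes no_atom: "\<And>a. a \<le> w \<Longrightarrow> \<not> atom a"
    and linear_f: "linear f" and f_nonneg: "\<And>x. 0 \<le> x \<Longrightarrow> 0 \<le> f x"
    and f_le_norm: "\<And>x. \<bar>f x\<bar> \<le> norm x"
begin

lemma f_mono: "x \<le> z \<Longrightarrow> f x \<le> f z"
  using f_nonneg[of "z - x"] by (simp add: linear_diff[OF linear_f])

lemma continuous_on_f: "continuous_on S f"
  using f_le_norm linear_f
  by (intro linear_continuous_on bounded_linear_intro[where K = 1])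
    (simp_all add: linear_add linear_scale)

lemma closed_f_sublevels: "closed {x. f x \<le> c}" "closed {x. c \<le> f x}"
  using continuous_on_f[of UNIV]
  by (intro closed_Collect_le continuous_on_const; assumption)+

text \<open>If all positive values were at least \<open>d\<close>, the components below
  \<open>u\<close> with such values would form a compact set with a minimal element; splitting that
  element leaves a part of positive value strictly below it.\<close>

lemma ex_small_component:
  assumes u: "u \<in> components" "f u > 0" and d: "d > 0"
  shows "\<exists>v\<in>components. v \<le> u \<and> 0 < f v \<and> f v < d"
proof (rule ccontr)
  assume "\<not> (\<exists>v\<in>components. v \<le> u \<and> 0 < f v \<and> f v < d)"
  then have big: "d \<le> f v" if "v \<in> components" "v \<le> u" "0 < f v" for v
    using that by force
  define S where "S = components \<inter> ({v. v \<le> u} \<inter> {v. d \<le> f v})"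
  have "compact S" unfolding S_def
    by (intro compact_Int_closed compact_components closed_Int closed_atMost_lattice closed_f_sublevels)
  moreover have "u \<in> S" using u big by (simp add: S_def)
  ultimately obtain v where v: "v \<in> S" and min: "\<And>e. e \<in> S \<Longrightarrow> e \<le> v \<Longrightarrow> e = v"
    using compact_minimal[of S] by blast
  have vS: "v \<in> components" "v \<le> u" "d \<le> f v" using v by (simp_all add: S_def)
  have "v \<noteq> 0" using vS d by (auto simp: linear_0[OF linear_f])
  moreover have "\<not> atom v" by (rule no_atom[OF component_le[OF vS(1)]])
  ultimately obtain e where e: "e \<in> components" "e \<le> v" "e \<noteq> 0" "e \<noteq> v"
    using component_split_no_atom[OF vS(1)] by blast
  have e2: "v - e \<in> components" by (rule component_diff[OF vS(1) e(1,2)])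
  have "f v = f e + f (v - e)" by (simp add: linear_diff[OF linear_f])
  then have "0 < f e \<or> 0 < f (v - e)" using vS(3) d by linarith
  then show False
  proof
    assume "0 < f e"
    moreover have "e \<le> u" using e(2) vS(2) by (rule order_trans)
    ultimately have "e \<in> S" using big e(1) by (simp add: S_def)
    then show False using min e(2,4) by blast
  next
    assume "0 < f (v - e)"
    moreover have le: "v - e \<le> v" using component_nonneg[OF e(1)] by simp
    moreover have "v - e \<le> u" using le vS(2) by (rule order_trans)
    ultimately have "v - e \<in> S" using big e2 by (simp add: S_def)
    then have "v - e = v" using min le by blast
    then show False using e(3) by simp
  qed
qed

text \<open>Sierpinski's argument for diffuse measures: by compactness a largest value not above the
  half is attained, and if it were too small, a small component of the rest could be added.\<close>

lemma ex_half_component: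
  assumes u: "u \<in> components"
  shows "\<exists>v\<in>components. v \<le> u \<and> f v = f u / 2"
proof -
  define S where "S = components \<inter> ({v. v \<le> u} \<inter> {v. f v \<le> f u / 2})"
  have "compact S" unfolding S_def
    by (intro compact_Int_closed compact_components closed_Int closed_atMost_lattice closed_f_sublevels)
  moreover have "0 \<in> S"
    using zero_component component_nonneg[OF u] f_nonneg[of u] by (simp add: S_def linear_0[OF linear_f])
  ultimately obtain v where v: "v \<in> S" and max: "\<And>e. e \<in> S \<Longrightarrow> f e \<le> f v"
    using continuous_attains_sup[of S f] continuous_on_f by blast
  have vS: "v \<in> components" "v \<le> u" "f v \<le> f u / 2" using v by (simp_all add: S_def)
  have "f v = f u / 2"
  proof (rule ccontr)
    assume "f v \<noteq> f u / 2"
    then have lt: "f v < f u / 2" using vS(3) by simp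
    have r: "u - v \<in> components" by (rule component_diff[OF u vS(1,2)])
    have "f (u - v) > 0"
      using lt f_nonneg[OF component_nonneg[OF u]] by (simp add: linear_diff[OF linear_f])
    moreover have "f u / 2 - f v > 0" using lt by simp
    ultimately obtain e where e: "e \<in> components" "e \<le> u - v" "0 < f e" "f e < f u / 2 - f v"
      using ex_small_component[OF r] by blast
    have le: "v + e \<le> u" using e(2) by (simp add: le_diff_eq add.commute)
    then have "v + e \<le> w" using component_le[OF u] by (rule order_trans)
    then have "v + e \<in> components" by (rule component_add[OF vS(1) e(1)])
    then have "v + e \<in> S" using le e(4) by (simp add: S_def linear_add[OF linear_f])
    from max[OF this] show False using e(3) by (simp add: linear_add[OF linear_f])
  qed
  then show ?thesis using vS by blast
qed

text \<open>Half of \<open>u\<close>, independent of \<open>X\<close> as a Rademacher function is of finitely many coarser ones.\<close>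

lemma ex_independent_component:
  assumes "finite X" "X \<subseteq> components" "u \<in> components"
  shows "\<exists>e\<in>components. e \<le> u \<and> f e = f u / 2 \<and> (\<forall>x\<in>X. f (inf e x) = f (inf u x) / 2)"
  using assms
proof (induction X arbitrary: u)
  case empty
  then show ?case using ex_half_component by simp
next
  case (insert x X)
  have x: "x \<in> components" and X: "X \<subseteq> components" and u: "u \<in> components" using insert.prems by auto
  \<comment> \<open>Cutting \<open>u\<close> along \<open>x\<close> and halving each piece
    independently of \<open>X\<close> makes the sum of the halves independent of \<open>x\<close> as
    well.\<close>
  define u1 u2 where "u1 = inf u x" and "u2 = u - inf u x"
  have u1: "u1 \<in> components" unfolding u1_def by (rule component_inf[OF u x])
  have u2: "u2 \<in> components" using component_diff[OF u u1] by (simp add: u1_def u2_def)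
  have u12: "u = u1 + u2" by (simp add: u1_def u2_def)
  have u_le: "u1 + u2 \<le> w" using component_le[OF u] u12 by simp
  obtain e1 where e1: "e1 \<in> components" "e1 \<le> u1" "f e1 = f u1 / 2"
    "\<And>z. z \<in> X \<Longrightarrow> f (inf e1 z) = f (inf u1 z) / 2"
    using insert.IH[OF X u1] by blast
  obtain e2 where e2: "e2 \<in> components" "e2 \<le> u2" "f e2 = f u2 / 2"
    "\<And>z. z \<in> X \<Longrightarrow> f (inf e2 z) = f (inf u2 z) / 2"
    using insert.IH[OF X u2] by blast
  have le: "e1 + e2 \<le> u" unfolding u12 by (intro add_mono e1 e2)
  then have le_w: "e1 + e2 \<le> w" using component_le[OF u] by (rule order_trans)
  have "f (inf (e1 + e2) z) = f (inf u z) / 2" if "z \<in> X" for z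
  proof -
    have z: "z \<in> components" using that X by blast
    show ?thesis
      unfolding component_inf_add[OF e1(1) e2(1) z le_w] u12 component_inf_add[OF u1 u2 z u_le]
      using e1(4)[OF that] e2(4)[OF that] by (simp add: linear_add[OF linear_f])
  qed
  moreover have "f (inf (e1 + e2) x) = f (inf u x) / 2"
  proof -
    have "u1 \<le> x" by (simp add: u1_def)
    then have "inf e1 x = e1" using e1(2) by (simp add: inf_absorb1)
    moreover have "inf u2 x = 0"
    proof -
      have "inf u1 x = u1" using \<open>u1 \<le> x\<close> by (simp add: inf_absorb1)
      then have "u1 + inf u2 x = inf u x"
        using component_inf_add[OF u1 u2 x u_le] u12 by simp
      then show ?thesis by (simp add: u1_def)
    qed
    then have "inf e2 x = 0"
      using inf_mono[OF e2(2) order_refl, of x] component_nonneg[OF e2(1)] component_nonneg[OF x]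
      by (simp add: antisym)
    ultimately have "inf (e1 + e2) x = e1"
      using component_inf_add[OF e1(1) e2(1) x le_w] by simp
    then show ?thesis using e1(3) by (simp add: u1_def)
  qed
  moreover have "f (e1 + e2) = f u / 2"
    using e1(3) e2(3) unfolding u12 by (simp add: linear_add[OF linear_f])
  moreover have "e1 + e2 \<in> components" by (rule component_add[OF e1(1) e2(1) le_w])
  ultimately show ?case using le by (intro bexI[of _ "e1 + e2"]) auto
qed

text \<open>A component \<open>e\<close> independent of a finite net violates the net:
  \<open>f (inf e x)\<close> is half of \<open>f x\<close>, so \<open>f \<bar>e - x\<bar>\<close> is
  at least \<open>f e + f x - f x = f w / 2\<close>, and so is the distance of \<open>e\<close> from
  each \<open>x\<close>.\<close>

lemma f_w_le_zero: "f w \<le> 0"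
proof (rule ccontr)
  assume "\<not> f w \<le> 0"
  then have pos: "f w / 2 > 0" by simp
  have "components \<subseteq> (\<Union>c\<in>components. ball c (f w / 2))" using pos by fastforce
  then obtain X where X: "X \<subseteq> components" "finite X" "components \<subseteq> (\<Union>c\<in>X. ball c (f w / 2))"
    using compactE_image[OF compact_components, of components "\<lambda>c. ball c (f w / 2)"] by auto
  obtain e where e: "e \<in> components" "f e = f w / 2" "\<And>x. x \<in> X \<Longrightarrow> f (inf e x) = f (inf w x) / 2"
    using ex_independent_component[OF X(2,1) w_component] by blast
  obtain x where x: "x \<in> X" "dist x e < f w / 2" using X(3) e(1) by auto
  have "inf w x = x" using x(1) X(1) component_le[of x] by (auto intro: inf_absorb2)
  then have "f (inf e x) = f x / 2" using e(3)[OF x(1)] by simp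
  moreover have "f (e + x) \<le> f (2 *\<^sub>R inf e x + \<bar>e - x\<bar>)"
    by (rule f_mono[OF add_le_inf_abs_diff])
  ultimately have "f w / 2 \<le> f \<bar>e - x\<bar>"
    using e(2) by (simp add: linear_add[OF linear_f] linear_scale[OF linear_f])
  also have "\<dots> \<le> norm (e - x)" using f_le_norm[of "\<bar>e - x\<bar>"] by simp
  finally show False using x(2) by (simp add: dist_norm norm_minus_commute)
qed

end

lemma ex_atom:
  assumes "w \<noteq> 0" shows "\<exists>a\<le>w. atom a"
proof (rule ccontr)
  assume no_atom: "\<not> (\<exists>a\<le>w. atom a)"
  obtain f :: "'a \<Rightarrow> real" where f: "linear f" "\<And>x. 0 \<le> x \<Longrightarrow> 0 \<le> f x" "\<And>x. \<bar>f x\<bar> \<le> norm x"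
    "f w = norm w"
    using ex_positive_functional[OF w_nonneg] by blast
  have "f w \<le> 0" using no_atom by (intro f_w_le_zero f) blast
  then show False using assms f(4) by simp
qed

end

section \<open>Positive representations\<close>

lemma positive_operator_mono:
  assumes "positive_operator f" "x \<le> z" shows "f x \<le> f z"
proof -
  have "0 \<le> f (z - x)" using assms by (simp add: positive_operator_def)
  moreover have "f (z - x) = f z - f x"
    using assms(1) by (simp add: positive_operator_def linear_diff)
  ultimately show ?thesis by simp
qed

lemma positive_operator_abs:
  assumes "positive_operator f" shows "\<bar>f x\<bar> \<le> f \<bar>x\<bar>"
proof (rule abs_leI)
  show "f x \<le> f \<bar>x\<bar>" by (rule positive_operator_mono[OF assms abs_ge_self])
  have "f (- x) \<le> f \<bar>x\<bar>" by (rule positive_operator_mono[OF assms abs_ge_minus_self])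
  then show "- f x \<le> f \<bar>x\<bar>" using assms by (simp add: positive_operator_def linear_neg)
qed

locale positive_bounded_representation =
  fixes T :: "'s::ab_semigroup_add \<Rightarrow> 'a::banach_lattice \<Rightarrow>\<^sub>L 'a" and y :: 'a
  assumes positive: "positive_representation T"
    and bounded: "bounded_representation T"
    and y_nonneg: "0 \<le> y"
    and y_fixed: "fixed_point T y"
begin

lemma T_add: "T (s + t) x = T s (T t x)"
  using bounded by (simp add: bounded_representation_def representation_def)

lemma T_commute: "T s (T t x) = T t (T s x)"
  by (metis T_add add.commute)

lemma T_positive: "positive_operator (T t)"
  using positive by (simp add: positive_representation_def)

lemma T_mono: "x \<le> z \<Longrightarrow> T t x \<le> T t z"
  by (rule positive_operator_mono[OF T_positive])

lemma T_nonneg: "0 \<le> x \<Longrightarrow> 0 \<le> T t x"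
  using T_mono[of 0 x t] by (simp add: blinfun.zero_right)

lemma T_abs: "\<bar>T t x\<bar> \<le> T t \<bar>x\<bar>"
  by (rule positive_operator_abs[OF T_positive])

lemma T_y: "T t y = y"
  using y_fixed by (simp add: fixed_point_def)

lemma T_abs_le: "\<bar>x\<bar> \<le> c *\<^sub>R y \<Longrightarrow> \<bar>T t x\<bar> \<le> c *\<^sub>R y"
  using T_mono[of "\<bar>x\<bar>" "c *\<^sub>R y" t] order_trans[OF T_abs[of t x]]
  by (simp add: blinfun.scaleR_right T_y)

lemma T_abs_le_y: "\<bar>x\<bar> \<le> y \<Longrightarrow> \<bar>T t x\<bar> \<le> y"
  using T_abs_le[of x 1 t] by simp

text \<open>At least 1, so as to bound the identity too, which need not belong to the
  representation.\<close>

definition bound :: real where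
  "bound = (SOME M. 1 \<le> M \<and> (\<forall>t. norm (T t) \<le> M))"

lemma bound_ge_1: "1 \<le> bound" and norm_T_le: "norm (T t) \<le> bound"
proof -
  have "bounded (range T)" using bounded by (simp add: bounded_representation_def)
  then obtain M where M: "\<And>t. norm (T t) \<le> M" by (auto simp: bounded_iff)
  have "1 \<le> max 1 M \<and> (\<forall>t. norm (T t) \<le> max 1 M)" using M by (simp add: le_max_iff_disj)
  then have "1 \<le> bound \<and> (\<forall>t. norm (T t) \<le> bound)"
    unfolding bound_def by (rule someI)
  then show "1 \<le> bound" "norm (T t) \<le> bound" by auto
qed

lemma norm_T_apply_le: "norm (T t x) \<le> bound * norm x"
  by (meson mult_right_mono norm_T_le norm_blinfun norm_ge_zero order_trans)

text \<open>Working with these \<open>v\<close> replaces the decomposition of \<open>T t\<close> into its AM-compact part and the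
  disjoint rest, which would need the lattice of regular operators.\<close>

definition essentially_bounded :: "'a \<Rightarrow> 's \<Rightarrow> bool" where
  "essentially_bounded v t \<longleftrightarrow> (\<forall>e>0. \<exists>F. finite F \<and>
    (\<forall>x. \<bar>x\<bar> \<le> y \<longrightarrow> (\<exists>m\<in>F. norm (pprt (\<bar>T t x - m\<bar> - v)) < e)))"

lemma essentially_bounded_y: "essentially_bounded y t"
  unfolding essentially_bounded_def
proof (intro allI impI)
  fix e :: real assume "e > 0"
  have "norm (pprt (\<bar>T t x - 0\<bar> - y)) < e" if "\<bar>x\<bar> \<le> y" for x
    using T_abs_le_y[OF that, of t] \<open>e > 0\<close> by simp
  then show "\<exists>F. finite F \<and> (\<forall>x. \<bar>x\<bar> \<le> y \<longrightarrow> (\<exists>m\<in>F. norm (pprt (\<bar>T t x - m\<bar> - y)) < e))"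
    by (intro exI[of _ "{0}"]) simp
qed

lemma essentially_bounded_add:
  assumes "essentially_bounded v t" shows "essentially_bounded v (t + s)"
  unfolding essentially_bounded_def
proof (intro allI impI)
  fix e :: real assume "e > 0"
  then obtain F where "finite F"
    "\<And>x. \<bar>x\<bar> \<le> y \<Longrightarrow> \<exists>m\<in>F. norm (pprt (\<bar>T t x - m\<bar> - v)) < e"
    using assms unfolding essentially_bounded_def by blast
  then show "\<exists>F. finite F \<and> (\<forall>x. \<bar>x\<bar> \<le> y \<longrightarrow>
      (\<exists>m\<in>F. norm (pprt (\<bar>T (t + s) x - m\<bar> - v)) < e))"
    unfolding T_add using T_abs_le_y by blast
qed

text \<open>\<open>m\<close> is the midpoint of the intersection of \<open>[m1 - v1, m1 + v1]\<close> and \<open>[m2 - v2, m2 + v2]\<close>.\<close>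

lemma interval_midpoint:
  fixes w m1 m2 v1 v2 :: "'b::banach_lattice"
  defines "m \<equiv> (1/2) *\<^sub>R (sup (m1 - v1) (m2 - v2) + inf (m1 + v1) (m2 + v2))"
  shows "norm (pprt (\<bar>w - m\<bar> - inf v1 v2))
    \<le> norm (pprt (\<bar>w - m1\<bar> - v1)) + norm (pprt (\<bar>w - m2\<bar> - v2))"
proof -
  define A B g1 g2 where "A = sup (m1 - v1) (m2 - v2)" and "B = inf (m1 + v1) (m2 + v2)"
    and "g1 = pprt (\<bar>w - m1\<bar> - v1)" and "g2 = pprt (\<bar>w - m2\<bar> - v2)"
  have nn: "0 \<le> g1" "0 \<le> g2" by (simp_all add: g1_def g2_def)
  \<comment> \<open>\<open>g1\<close> and \<open>g2\<close> measure by how much \<open>w\<close>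
    leaves the two intervals; with the tolerance \<open>g1 + g2\<close> it satisfies the bounds of
    both. Half of \<open>B - A\<close> is at most each of the two radii, and \<open>A\<close> need
    not lie below \<open>B\<close>.\<close>
  have bounds: "w - (g1 + g2) \<le> k + v" "k - v \<le> w + (g1 + g2)"
    if "pprt (\<bar>w - k\<bar> - v) \<le> g1 + g2" for k v
  proof -
    have "\<bar>w - k\<bar> - v \<le> g1 + g2"
      using that unfolding pprt_def by simp
    then have "\<bar>w - k\<bar> \<le> (g1 + g2) + v"
      by (simp only: diff_le_eq)
    then have "w - k \<le> (g1 + g2) + v" "- (w - k) \<le> (g1 + g2) + v"
      unfolding abs_le_iff by auto
    then show "w - (g1 + g2) \<le> k + v" "k - v \<le> w + (g1 + g2)"
      by (simp_all add: diff_le_eq algebra_simps)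
  qed
  have up1: "w - (g1 + g2) \<le> m1 + v1" and lo1: "m1 - v1 \<le> w + (g1 + g2)"
    using bounds[of m1 v1] nn unfolding g1_def by simp_all
  have up2: "w - (g1 + g2) \<le> m2 + v2" and lo2: "m2 - v2 \<le> w + (g1 + g2)"
    using bounds[of m2 v2] nn unfolding g2_def by simp_all
  have up: "w - (g1 + g2) \<le> B" unfolding B_def using up1 up2 by (rule le_infI)
  have lo: "A \<le> w + (g1 + g2)" unfolding A_def using lo1 lo2 by (rule sup_least)
  have "B - A \<le> (m1 + v1) - (m1 - v1)" "B - A \<le> (m2 + v2) - (m2 - v2)"
    unfolding A_def B_def by (intro diff_mono inf_le1 inf_le2 sup_ge1 sup_ge2)+
  then have "B - A \<le> 2 *\<^sub>R v1" "B - A \<le> 2 *\<^sub>R v2"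
    by (simp_all add: scaleR_2)
  then have "(1/2) *\<^sub>R (B - A) \<le> (1/2) *\<^sub>R (2 *\<^sub>R v1)" "(1/2) *\<^sub>R (B - A) \<le> (1/2) *\<^sub>R (2 *\<^sub>R v2)"
    by (intro scaleR_left_mono; simp)+
  then have rad: "(1/2) *\<^sub>R (B - A) \<le> inf v1 v2"
    by (intro le_infI) simp_all
  have mAB: "m = (1/2) *\<^sub>R (A + B)" by (simp add: m_def A_def B_def)
  have B_eq: "B = m + (1/2) *\<^sub>R (B - A)" and A_eq: "A = m - (1/2) *\<^sub>R (B - A)"
    unfolding mAB by (simp_all flip: scaleR_add_right scaleR_diff_right)
  have "w \<le> m + inf v1 v2 + (g1 + g2)"
  proof -
    have "w \<le> B + (g1 + g2)" using up by (simp add: diff_le_eq)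
    also have "\<dots> = m + (1/2) *\<^sub>R (B - A) + (g1 + g2)" using B_eq by simp
    also have "\<dots> \<le> m + inf v1 v2 + (g1 + g2)" by (intro add_mono rad order_refl)
    finally show ?thesis .
  qed
  moreover have "m \<le> w + inf v1 v2 + (g1 + g2)"
  proof -
    have "m = A + (1/2) *\<^sub>R (B - A)" using A_eq by (metis diff_add_cancel)
    also have "\<dots> \<le> (w + (g1 + g2)) + inf v1 v2" by (intro add_mono rad lo)
    finally show ?thesis by (simp add: add.assoc add.commute[of "inf v1 v2"])
  qed
  ultimately have "\<bar>w - m\<bar> \<le> inf v1 v2 + (g1 + g2)"
    by (intro abs_leI) (simp_all add: diff_le_eq add.assoc add.commute add.left_commute)
  then have "\<bar>w - m\<bar> - inf v1 v2 \<le> g1 + g2" by (simp add: diff_le_eq add.commute)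
  then have "pprt (\<bar>w - m\<bar> - inf v1 v2) \<le> g1 + g2"
    unfolding pprt_def using nn by (intro sup_least add_nonneg_nonneg)
  then have "norm (pprt (\<bar>w - m\<bar> - inf v1 v2)) \<le> norm (g1 + g2)"
    by (intro norm_mono_nonneg zero_le_pprt)
  also have "\<dots> \<le> norm g1 + norm g2" by (rule norm_triangle_ineq)
  finally show ?thesis by (simp add: g1_def g2_def)
qed

lemma essentially_bounded_inf:
  assumes "essentially_bounded v1 t" "essentially_bounded v2 t"
  shows "essentially_bounded (inf v1 v2) t"
  unfolding essentially_bounded_def
proof (intro allI impI)
  fix e :: real assume "e > 0"
  obtain F1 where F1: "finite F1"
    "\<And>x. \<bar>x\<bar> \<le> y \<Longrightarrow> \<exists>m\<in>F1. norm (pprt (\<bar>T t x - m\<bar> - v1)) < e / 2"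
    using assms(1) \<open>e > 0\<close> unfolding essentially_bounded_def by (meson half_gt_zero)
  obtain F2 where F2: "finite F2"
    "\<And>x. \<bar>x\<bar> \<le> y \<Longrightarrow> \<exists>m\<in>F2. norm (pprt (\<bar>T t x - m\<bar> - v2)) < e / 2"
    using assms(2) \<open>e > 0\<close> unfolding essentially_bounded_def by (meson half_gt_zero)
  define F where "F = (\<lambda>(m1, m2). (1/2) *\<^sub>R (sup (m1 - v1) (m2 - v2) + inf (m1 + v1) (m2 + v2))) ` (F1 \<times> F2)"
  have "\<exists>m\<in>F. norm (pprt (\<bar>T t x - m\<bar> - inf v1 v2)) < e" if x: "\<bar>x\<bar> \<le> y" for x
  proof -
    obtain m1 m2 where m: "m1 \<in> F1" "m2 \<in> F2" "norm (pprt (\<bar>T t x - m1\<bar> - v1)) < e / 2"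
      "norm (pprt (\<bar>T t x - m2\<bar> - v2)) < e / 2"
      using F1(2)[OF x] F2(2)[OF x] by blast
    have "(1/2) *\<^sub>R (sup (m1 - v1) (m2 - v2) + inf (m1 + v1) (m2 + v2)) \<in> F"
      unfolding F_def using m by force
    moreover have "norm (pprt (\<bar>T t x - m1\<bar> - v1)) + norm (pprt (\<bar>T t x - m2\<bar> - v2)) < e"
      using m by simp
    ultimately show ?thesis
      using interval_midpoint[of "T t x" m1 v1 m2 v2] by (meson order_le_less_trans)
  qed
  moreover have "finite F" using F1(1) F2(1) by (simp add: F_def)
  ultimately show "\<exists>F. finite F \<and> (\<forall>x. \<bar>x\<bar> \<le> y \<longrightarrow> (\<exists>m\<in>F. norm (pprt (\<bar>T t x - m\<bar> - inf v1 v2)) < e))"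
    by blast
qed

text \<open>In \<open>T s = K + R\<close> the part \<open>K\<close> maps \<open>[-y, y]\<close> into
  a relatively compact set and only adds finitely many centres, while the positive \<open>R\<close>
  turns the radius \<open>v\<close> into \<open>R v\<close>. Compared with \<open>T s v\<close> the
  radius has shrunk by \<open>K v\<close>.\<close>

lemma essentially_bounded_rest:
  assumes v: "essentially_bounded v t" and K: "AM_compact K" "positive_operator K"
    and R: "positive_operator (\<lambda>x. T s x - K x)"
  shows "essentially_bounded (T s v - K v) (s + t)"
  unfolding essentially_bounded_def
proof (intro allI impI)
  fix e :: real assume "e > 0"
  define R where "R = (\<lambda>x. T s x - K x)"
  have Rpos: "positive_operator R" using R by (simp add: R_def)
  have R_add: "R (a + b) = R a + R b" and R_diff: "R (a - b) = R a - R b" for a b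
    using Rpos by (simp_all add: positive_operator_def linear_add linear_diff)
  have R_norm: "norm (R u) \<le> bound * norm u" if "0 \<le> u" for u
  proof -
    have "0 \<le> R u" using Rpos that by (simp add: positive_operator_def)
    moreover have "R u \<le> T s u" using K(2) that by (simp add: positive_operator_def R_def)
    ultimately show ?thesis using norm_mono_nonneg norm_T_apply_le order_trans by blast
  qed
  \<comment> \<open>One half of \<open>e\<close> pays for the net of the compact part. The other
    half pays for the excess under \<open>R\<close>, which on positive vectors is bounded by
    \<open>bound\<close> because there it is dominated by \<open>T s\<close>.\<close>
  define d where "d = e / (2 * bound)"
  have d: "d > 0" using \<open>e > 0\<close> bound_ge_1 by (simp add: d_def)
  obtain F where F: "finite F" "\<And>x. \<bar>x\<bar> \<le> y \<Longrightarrow> \<exists>m\<in>F. norm (pprt (\<bar>T t x - m\<bar> - v)) < d"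
    using v d unfolding essentially_bounded_def by blast
  have "compact (closure (K ` {-y..y}))" using K(1) by (simp add: AM_compact_def)
  then obtain G where G: "finite G" "closure (K ` {-y..y}) \<subseteq> (\<Union>k\<in>G. ball k (e / 2))"
    using \<open>e > 0\<close> unfolding compact_eq_totally_bounded by (meson half_gt_zero)
  define H where "H = (\<lambda>(k, m). k + R m) ` (G \<times> F)"
  have "\<exists>m\<in>H. norm (pprt (\<bar>T (s + t) x - m\<bar> - (T s v - K v))) < e" if x: "\<bar>x\<bar> \<le> y" for x
  proof -
    obtain m where m: "m \<in> F" "norm (pprt (\<bar>T t x - m\<bar> - v)) < d" using F(2)[OF x] by blast
    have "T t x \<in> {-y..y}" using T_abs_le_y[OF x, of t] abs_le_iff[of "T t x" y] minus_le_iff[of "T t x" y] by simp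
    then have "K (T t x) \<in> closure (K ` {-y..y})" by (rule subsetD[OF closure_subset imageI])
    then obtain k where k: "k \<in> G" "norm (k - K (T t x)) < e / 2"
      using subsetD[OF G(2)] by (auto simp: dist_norm)
    define g where "g = pprt (\<bar>T t x - m\<bar> - v)"
    have "\<bar>T t x - m\<bar> - v \<le> g" by (simp add: g_def pprt_def)
    then have le: "\<bar>T t x - m\<bar> \<le> v + g" by (simp add: diff_le_eq add.commute)
    have "\<bar>R (T t x) - R m\<bar> \<le> R \<bar>T t x - m\<bar>"
      unfolding R_diff[symmetric] by (rule positive_operator_abs[OF Rpos])
    also have "\<dots> \<le> R v + R g"
      unfolding R_add[symmetric] by (rule positive_operator_mono[OF Rpos le])
    finally have Rle: "\<bar>R (T t x) - R m\<bar> \<le> R v + R g" .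
    have "T (s + t) x - (k + R m) = (K (T t x) - k) + (R (T t x) - R m)"
      unfolding T_add by (simp add: R_def)
    then have "\<bar>T (s + t) x - (k + R m)\<bar> \<le> \<bar>K (T t x) - k\<bar> + \<bar>R (T t x) - R m\<bar>"
      by (simp only: abs_triangle_ineq)
    also have "\<dots> \<le> \<bar>K (T t x) - k\<bar> + (R v + R g)"
      using Rle by (rule add_left_mono)
    finally have "\<bar>T (s + t) x - (k + R m)\<bar> \<le> (\<bar>K (T t x) - k\<bar> + R g) + R v"
      by (simp only: add.assoc add.commute[of "R v"])
    then have "\<bar>T (s + t) x - (k + R m)\<bar> - R v \<le> \<bar>K (T t x) - k\<bar> + R g"
      by (simp only: diff_le_eq)
    moreover have "0 \<le> \<bar>K (T t x) - k\<bar> + R g"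
      using Rpos by (intro add_nonneg_nonneg abs_ge_zero) (simp add: positive_operator_def g_def)
    ultimately have "pprt (\<bar>T (s + t) x - (k + R m)\<bar> - R v) \<le> \<bar>K (T t x) - k\<bar> + R g"
      unfolding pprt_def by (rule sup_least)
    then have "norm (pprt (\<bar>T (s + t) x - (k + R m)\<bar> - R v)) \<le> norm (\<bar>K (T t x) - k\<bar> + R g)"
      by (intro norm_mono_nonneg zero_le_pprt)
    also have "\<dots> \<le> norm (K (T t x) - k) + bound * norm g"
      using norm_triangle_ineq[of "\<bar>K (T t x) - k\<bar>" "R g"] R_norm[of g] by (simp add: g_def)
    also have "\<dots> < e / 2 + bound * d"
      using k m(2) bound_ge_1 unfolding g_def
      by (intro add_strict_mono) (simp_all add: norm_minus_commute)
    also have "\<dots> = e" using bound_ge_1 by (simp add: d_def)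
    finally have "norm (pprt (\<bar>T (s + t) x - (k + R m)\<bar> - R v)) < e" .
    moreover have "k + R m \<in> H" using k m by (force simp: H_def)
    ultimately show ?thesis unfolding R_def by blast
  qed
  moreover have "finite H" using F(1) G(1) by (simp add: H_def)
  ultimately show "\<exists>F. finite F \<and> (\<forall>x. \<bar>x\<bar> \<le> y \<longrightarrow>
      (\<exists>m\<in>F. norm (pprt (\<bar>T (s + t) x - m\<bar> - (T s v - K v))) < e))"
    by blast
qed

lemma essentially_bounded_T:
  assumes "essentially_bounded v t" shows "essentially_bounded (T s v) (s + t)"
proof -
  have "AM_compact (\<lambda>x::'a. 0::'a)" unfolding AM_compact_def
  proof (intro conjI allI)
    show "linear (\<lambda>x::'a. 0::'a)" by (rule linear_zero)
    have "(\<lambda>x::'a. 0::'a) ` {a..b} \<subseteq> {0}" for a b :: 'a by auto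
    then show "compact (closure ((\<lambda>x::'a. 0::'a) ` {a..b}))" for a b :: 'a
      by (metis closure_closed closed_singleton closure_mono compact_sing compact_empty subset_singletonD)
  qed
  moreover have "positive_operator (\<lambda>x::'a. 0::'a)"
    by (simp add: positive_operator_def linear_zero)
  ultimately show ?thesis
    using essentially_bounded_rest[OF assms, of "\<lambda>x. 0" s] T_positive by simp
qed

lemma asymptotically_compact:
  assumes oc: "order_continuous_norm TYPE('a)"
    and super: "\<And>x. super_fixed_point T x \<Longrightarrow> fixed_point T x"
    and lower: "\<And>x. fixed_point T x \<Longrightarrow> x > 0 \<Longrightarrow>
      \<exists>s K. AM_compact K \<and> positive_operator K \<and>
        positive_operator (\<lambda>v. T s v - K v) \<and> K x > 0"
    and e: "e > 0"
  shows "\<exists>t F. finite F \<and> (\<forall>m\<in>F. \<bar>m\<bar> \<le> y) \<and>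
    (\<forall>x. \<bar>x\<bar> \<le> y \<longrightarrow> (\<exists>m\<in>F. norm (T t x - T t m) < e))"
proof -
  define D where "D = {v. 0 \<le> v \<and> (\<exists>t. essentially_bounded v t)}"
  have dir: "\<exists>z\<in>D. z \<le> u \<and> z \<le> v" if uv: "u \<in> D" "v \<in> D" for u v
  proof -
    obtain t1 t2 where "essentially_bounded u t1" "essentially_bounded v t2"
      using uv by (auto simp: D_def)
    then have "essentially_bounded u (t1 + t2)" "essentially_bounded v (t1 + t2)"
      using essentially_bounded_add[of u t1 t2] essentially_bounded_add[of v t2 t1]
      by (simp_all add: add.commute)
    then have "essentially_bounded (inf u v) (t1 + t2)" by (rule essentially_bounded_inf)
    moreover have "0 \<le> inf u v" using uv by (simp add: D_def)
    ultimately have "inf u v \<in> D" unfolding D_def by auto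
    then show ?thesis by (intro bexI[of _ "inf u v"]) simp_all
  qed
  have ne: "D \<noteq> {}" using essentially_bounded_y y_nonneg by (auto simp: D_def)
  obtain d z where d: "\<And>n::nat. d n \<in> D" "d \<longlonglongrightarrow> z" and z: "\<And>v. v \<in> D \<Longrightarrow> z \<le> v"
    by (rule order_continuous_norm_directed[OF oc ne dir, of 0]) (auto simp: D_def)
  have z_nonneg: "0 \<le> z"
    by (rule tendsto_nonneg_lattice[OF d(2)]) (use d(1) in \<open>simp add: D_def\<close>)
  \<comment> \<open>By \<open>essentially_bounded_T\<close> each \<open>T s\<close> maps
    \<open>D\<close> into itself, and \<open>z\<close> is a lower bound of \<open>D\<close>.\<close>
  have Tz: "z \<le> T s z" for s
  proof (rule tendsto_le_lattice[OF tendsto_const])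
    show "(\<lambda>n. T s (d n)) \<longlonglongrightarrow> T s z" by (intro tendsto_intros d)
    show "z \<le> T s (d n)" for n
      using d(1)[of n] essentially_bounded_T T_nonneg by (intro z) (auto simp: D_def)
  qed
  have z_fixed: "fixed_point T z"
    using z_nonneg Tz by (intro super) (simp add: super_fixed_point_def)
  have "z = 0"
  proof (rule ccontr)
    assume "z \<noteq> 0"
    then have "z > 0" using z_nonneg by (simp add: less_le)
    then obtain s K where K: "AM_compact K" "positive_operator K"
      "positive_operator (\<lambda>v. T s v - K v)" "K z > 0"
      using lower[OF z_fixed] by blast
    define R where "R = (\<lambda>v. T s v - K v)"
    have Rpos: "positive_operator R" using K by (simp add: R_def)
    \<comment> \<open>The smaller operator \<open>R\<close> also maps \<open>D\<close> into itself.
      In the limit \<open>z <= R z = z - K z\<close>, which contradicts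
      \<open>K z > 0\<close>.\<close>
    have "z \<le> R (d n)" for n
    proof (rule z)
      have "0 \<le> d n" using d(1)[of n] by (simp add: D_def)
      then have "0 \<le> R (d n)" using Rpos by (simp add: positive_operator_def)
      then show "R (d n) \<in> D"
        using d(1)[of n] essentially_bounded_rest[OF _ K(1-3)] by (auto simp: D_def R_def)
    qed
    moreover have "(\<lambda>n. R (d n)) \<longlonglongrightarrow> R z"
    proof -
      \<comment> \<open>\<open>K\<close> and \<open>R\<close> are known only as linear maps; the
        convergence comes from the domination of \<open>R\<close> by \<open>T s\<close> on the
        positive vector \<open>d n - z\<close>.\<close>
      have "norm (R (d n) - R z) \<le> norm (T s (d n - z))" for n
      proof -
        have nn: "0 \<le> d n - z" using z d(1) by simp
        have "R (d n) - R z = R (d n - z)"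
          using Rpos by (simp add: positive_operator_def linear_diff)
        moreover have "0 \<le> R (d n - z)" using nn Rpos by (simp add: positive_operator_def)
        moreover have "R (d n - z) \<le> T s (d n - z)"
          using nn K(2) by (simp add: positive_operator_def R_def)
        ultimately show ?thesis by (simp add: norm_mono_nonneg)
      qed
      moreover have "(\<lambda>n. T s (d n - z)) \<longlonglongrightarrow> T s (z - z)"
        by (intro tendsto_intros d)
      then have "(\<lambda>n. norm (T s (d n - z))) \<longlonglongrightarrow> 0"
        by (simp add: blinfun.zero_right tendsto_norm_zero)
      ultimately show ?thesis by (rule LIMSEQ_norm_diff_le)
    qed
    ultimately have "z \<le> R z"
      using tendsto_le_lattice[OF tendsto_const[of z], of "\<lambda>n. R (d n)" "R z"] by blast
    then have "K z \<le> 0" using z_fixed by (simp add: R_def fixed_point_def)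
    then show False using K(4) by simp
  qed
  then have "d \<longlonglongrightarrow> 0" using d(2) by simp
  from LIMSEQ_D[OF this, of "e / 4"] e obtain n where n: "norm (d n) < e / 4" by auto
  obtain t where t: "essentially_bounded (d n) t" "0 \<le> d n" using d(1)[of n] by (auto simp: D_def)
  have "e / 4 > 0" using e by simp
  then obtain F where F: "finite F"
      "\<And>x. \<bar>x\<bar> \<le> y \<Longrightarrow> \<exists>m\<in>F. norm (pprt (\<bar>T t x - m\<bar> - d n)) < e / 4"
    using t(1) unfolding essentially_bounded_def by blast
  have near: "\<exists>m\<in>F. norm (T t x - m) < e / 2" if x: "\<bar>x\<bar> \<le> y" for x
  proof -
    obtain m where m: "m \<in> F" "norm (pprt (\<bar>T t x - m\<bar> - d n)) < e / 4" using F(2)[OF x] by blast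
    have "\<bar>T t x - m\<bar> - d n \<le> pprt (\<bar>T t x - m\<bar> - d n)" by (simp add: pprt_def)
    then have "\<bar>T t x - m\<bar> \<le> pprt (\<bar>T t x - m\<bar> - d n) + d n" by (simp only: diff_le_eq)
    then have "norm (T t x - m) \<le> norm (pprt (\<bar>T t x - m\<bar> - d n) + d n)"
      by (rule norm_le_abs_le)
    also have "\<dots> \<le> norm (pprt (\<bar>T t x - m\<bar> - d n)) + norm (d n)" by (rule norm_triangle_ineq)
    finally have "norm (T t x - m) < e / 2" using m(2) n by simp
    then show ?thesis using m(1) by blast
  qed
  \<comment> \<open>The centres are exchanged for images of vectors in \<open>[-y, y]\<close>, at
    the price of doubling the radius. Later arguments apply further operators to these vectors and
    need them in the interval.\<close>
  define c where "c m = (SOME x. \<bar>x\<bar> \<le> y \<and> norm (T t x - m) < e / 2)" for m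
  define G where "G = c ` {m\<in>F. \<exists>x. \<bar>x\<bar> \<le> y \<and> norm (T t x - m) < e / 2}"
  have c: "\<bar>c m\<bar> \<le> y \<and> norm (T t (c m) - m) < e / 2"
    if "\<exists>x. \<bar>x\<bar> \<le> y \<and> norm (T t x - m) < e / 2" for m
    unfolding c_def by (rule someI_ex[OF that])
  have "\<exists>m\<in>G. norm (T t x - T t m) < e" if x: "\<bar>x\<bar> \<le> y" for x
  proof -
    obtain m where m: "m \<in> F" "norm (T t x - m) < e / 2" using near[OF x] by blast
    then have ex: "\<exists>x. \<bar>x\<bar> \<le> y \<and> norm (T t x - m) < e / 2" using x by blast
    have "norm (T t x - T t (c m)) < e"
      using norm_triangle_ineq4[of "T t x - m" "T t (c m) - m"] c[OF ex] m(2) by simp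
    moreover have "c m \<in> G" using m(1) ex by (simp add: G_def)
    ultimately show ?thesis by blast
  qed
  moreover have "finite G" using F(1) by (simp add: G_def)
  moreover have "\<forall>m\<in>G. \<bar>m\<bar> \<le> y" using c by (auto simp: G_def)
  ultimately show ?thesis by blast
qed

text \<open>An equivalent norm that makes all \<open>T t\<close> contractive, and its limit along the semigroup, a
  seminorm that all \<open>T t\<close> preserve.\<close>

definition pnorm :: "'a \<Rightarrow> real" where
  "pnorm x = (SUP A\<in>insert id_blinfun (range T). norm (blinfun_apply A x))"

definition qnorm :: "'a \<Rightarrow> real" where
  "qnorm x = (INF t. pnorm (T t x))"

lemma bdd_above_pnorm: "bdd_above ((\<lambda>A. norm (blinfun_apply A x)) ` insert id_blinfun (range T))"
proof (rule bdd_aboveI2)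
  fix A assume "A \<in> insert id_blinfun (range T)"
  then show "norm (blinfun_apply A x) \<le> bound * norm x"
    using norm_T_apply_le bound_ge_1 mult_right_mono[of 1 bound "norm x"] by auto
qed

lemma norm_le_pnorm: "norm x \<le> pnorm x"
  using cSUP_upper[OF _ bdd_above_pnorm, of id_blinfun x] by (simp add: pnorm_def)

lemma norm_T_le_pnorm: "norm (T t x) \<le> pnorm x"
  using cSUP_upper[OF _ bdd_above_pnorm, of "T t" x] by (simp add: pnorm_def)

lemma pnorm_least: "norm x \<le> c \<Longrightarrow> (\<And>t. norm (T t x) \<le> c) \<Longrightarrow> pnorm x \<le> c"
  unfolding pnorm_def by (rule cSUP_least) auto

lemma pnorm_le: "pnorm x \<le> bound * norm x"
  using norm_T_apply_le bound_ge_1 mult_right_mono[of 1 bound "norm x"]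
  by (intro pnorm_least) auto

lemma pnorm_nonneg: "0 \<le> pnorm x"
  using norm_le_pnorm[of x] norm_ge_zero[of x] by linarith

lemma pnorm_triangle: "pnorm (x + z) \<le> pnorm x + pnorm z"
  by (rule pnorm_least) (auto simp: blinfun.add_right intro!: norm_triangle_le add_mono
      norm_le_pnorm norm_T_le_pnorm)

lemma pnorm_scaleR_le: "pnorm (c *\<^sub>R x) \<le> \<bar>c\<bar> * pnorm x"
  by (rule pnorm_least) (auto simp: blinfun.scaleR_right intro!: mult_left_mono
      norm_le_pnorm norm_T_le_pnorm)

lemma pnorm_scaleR: "pnorm (c *\<^sub>R x) = \<bar>c\<bar> * pnorm x"
proof (cases "c = 0")
  case True
  then show ?thesis using pnorm_scaleR_le[of 0 x] pnorm_nonneg[of 0] by simp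
next
  case False
  have "\<bar>c\<bar> * pnorm x \<le> \<bar>c\<bar> * (\<bar>1 / c\<bar> * pnorm (c *\<^sub>R x))"
    using pnorm_scaleR_le[of "1 / c" "c *\<^sub>R x"] False by (intro mult_left_mono) auto
  then show ?thesis using pnorm_scaleR_le[of c x] False by (simp add: abs_divide)
qed

lemma pnorm_minus: "pnorm (- x) = pnorm x"
  using pnorm_scaleR[of "-1" x] by simp

lemma pnorm_T_le: "pnorm (T s x) \<le> pnorm x"
  using norm_T_le_pnorm[of _ x] by (intro pnorm_least) (simp_all flip: T_add)

lemma pnorm_T_add_le: "pnorm (T (s + t) x) \<le> pnorm (T s x)"
  unfolding T_add T_commute[of s t] by (rule pnorm_T_le)

lemma pnorm_mono: "0 \<le> x \<Longrightarrow> x \<le> z \<Longrightarrow> pnorm x \<le> pnorm z"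
  by (rule pnorm_least)
    (rule order_trans[OF norm_mono_nonneg norm_le_pnorm]
      order_trans[OF norm_mono_nonneg[OF T_nonneg T_mono] norm_T_le_pnorm]; assumption)+

lemma bdd_below_qnorm: "bdd_below (range (\<lambda>t. pnorm (T t x)))"
  by (rule bdd_belowI2[of _ 0]) (rule pnorm_nonneg)

lemma qnorm_le: "qnorm x \<le> pnorm (T t x)"
  unfolding qnorm_def by (rule cINF_lower[OF bdd_below_qnorm]) simp

lemma qnorm_greatest: "(\<And>t. c \<le> pnorm (T t x)) \<Longrightarrow> c \<le> qnorm x"
  unfolding qnorm_def by (rule cINF_greatest) auto

lemma qnorm_nonneg: "0 \<le> qnorm x"
  by (rule qnorm_greatest) (rule pnorm_nonneg)

lemma qnorm_le_pnorm: "qnorm x \<le> pnorm x"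
  using qnorm_le pnorm_T_le order_trans by blast

lemma qnorm_approx:
  assumes "e > 0" obtains t where "pnorm (T t x) < qnorm x + e"
proof -
  have "\<not> (\<forall>t. qnorm x + e \<le> pnorm (T t x))"
    using qnorm_greatest[of "qnorm x + e" x] assms by auto
  then show thesis using that by (auto simp: not_le)
qed

lemma qnorm_triangle: "qnorm (x + z) \<le> qnorm x + qnorm z"
proof (rule field_le_epsilon)
  fix e :: real assume "e > 0"
  then have "e / 2 > 0" by simp
  obtain s where s: "pnorm (T s x) < qnorm x + e / 2" using qnorm_approx[OF \<open>e / 2 > 0\<close>] .
  obtain t where t: "pnorm (T t z) < qnorm z + e / 2" using qnorm_approx[OF \<open>e / 2 > 0\<close>] .
  have "qnorm (x + z) \<le> pnorm (T (s + t) (x + z))" by (rule qnorm_le)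
  also have "\<dots> \<le> pnorm (T (s + t) x) + pnorm (T (s + t) z)"
    unfolding blinfun.add_right by (rule pnorm_triangle)
  also have "\<dots> \<le> pnorm (T s x) + pnorm (T t z)"
    using pnorm_T_add_le[of s t x] pnorm_T_add_le[of t s z] by (simp add: add.commute)
  finally show "qnorm (x + z) \<le> qnorm x + qnorm z + e" using s t by simp
qed

lemma qnorm_minus: "qnorm (- x) = qnorm x"
  by (simp add: qnorm_def blinfun.minus_right pnorm_minus)

lemma qnorm_triangle_diff: "qnorm (x - z) \<le> qnorm x + qnorm z"
  using qnorm_triangle[of x "- z"] by (simp add: qnorm_minus)

lemma qnorm_scaleR_le: "qnorm (c *\<^sub>R x) \<le> \<bar>c\<bar> * qnorm x"
proof (rule field_le_epsilon)
  fix e :: real assume "e > 0"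
  then have e': "e / (\<bar>c\<bar> + 1) > 0" by (simp add: add_nonneg_pos)
  obtain s where s: "pnorm (T s x) < qnorm x + e / (\<bar>c\<bar> + 1)" using qnorm_approx[OF e'] .
  have "qnorm (c *\<^sub>R x) \<le> \<bar>c\<bar> * pnorm (T s x)"
    using qnorm_le[of "c *\<^sub>R x" s] by (simp add: blinfun.scaleR_right pnorm_scaleR)
  also have "\<dots> \<le> \<bar>c\<bar> * (qnorm x + e / (\<bar>c\<bar> + 1))"
    using s by (intro mult_left_mono) auto
  also have "\<dots> \<le> \<bar>c\<bar> * qnorm x + e"
    using \<open>e > 0\<close> by (simp add: distrib_left field_simps)
  finally show "qnorm (c *\<^sub>R x) \<le> \<bar>c\<bar> * qnorm x + e" .
qed

text \<open>The orbit of \<open>T s x\<close> is part of that of \<open>x\<close>, which gives one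
  inequality; the other holds since \<open>T s\<close> commutes with all \<open>T t\<close> and is
  contractive for \<open>pnorm\<close>.\<close>

lemma qnorm_T: "qnorm (T s x) = qnorm x"
proof (rule antisym)
  show "qnorm x \<le> qnorm (T s x)"
    by (rule qnorm_greatest) (simp add: qnorm_le flip: T_add)
  show "qnorm (T s x) \<le> qnorm x"
  proof (rule qnorm_greatest)
    fix t
    have "qnorm (T s x) \<le> pnorm (T t (T s x))" by (rule qnorm_le)
    also have "\<dots> \<le> pnorm (T t x)" unfolding T_commute[of t s] by (rule pnorm_T_le)
    finally show "qnorm (T s x) \<le> pnorm (T t x)" .
  qed
qed

lemma qnorm_mono: "0 \<le> x \<Longrightarrow> x \<le> z \<Longrightarrow> qnorm x \<le> qnorm z"
  by (rule qnorm_greatest, rule order_trans[OF qnorm_le pnorm_mono[OF T_nonneg T_mono]])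

lemma qnorm_le_norm: "qnorm x \<le> bound * norm x"
  using qnorm_le_pnorm[of x] pnorm_le[of x] by linarith

end

text \<open>\<open>multiple s n\<close> is \<open>n + 1\<close> times \<open>s\<close>: a semigroup has no zero element.\<close>

primrec multiple :: "'s::ab_semigroup_add \<Rightarrow> nat \<Rightarrow> 's" where
  "multiple s 0 = s"
| "multiple s (Suc n) = s + multiple s n"

lemma multiple_add: "multiple s (Suc (m + n)) = multiple s m + multiple s n"
  by (induction m) (simp_all add: add.assoc)

text \<open>With \<open>s + s\<close> even the zeroth multiple has a summand left after splitting
  off \<open>s\<close>; \<open>multiple s 0\<close> is only \<open>s\<close>.\<close>

lemma multiple_double: "\<exists>b. multiple (s + s) n = s + b"
  by (cases n) (auto simp: add.assoc)

section \<open>Recurrence and the splitting of the principal ideal\<close>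

locale asymptotically_compact_representation = positive_bounded_representation T y
  for T :: "'s::ab_semigroup_add \<Rightarrow> 'a::banach_lattice \<Rightarrow>\<^sub>L 'a" and y :: 'a +
  assumes finite_net: "e > 0 \<Longrightarrow> \<exists>t F. finite F \<and> (\<forall>m\<in>F. \<bar>m\<bar> \<le> y) \<and>
    (\<forall>x. \<bar>x\<bar> \<le> y \<longrightarrow> (\<exists>m\<in>F. norm (T t x - T t m) < e))"
begin

lemma finite_net_pnorm:
  assumes "e > 0"
  shows "\<exists>t F. finite F \<and> (\<forall>m\<in>F. \<bar>m\<bar> \<le> y) \<and>
    (\<forall>x. \<bar>x\<bar> \<le> y \<longrightarrow> (\<exists>m\<in>F. pnorm (T t x - T t m) < e))"
proof -
  have "e / bound > 0" using assms bound_ge_1 by simp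
  from finite_net[OF this] obtain t F where F: "finite F" "\<And>m. m \<in> F \<Longrightarrow> \<bar>m\<bar> \<le> y"
      "\<And>x. \<bar>x\<bar> \<le> y \<Longrightarrow> \<exists>m\<in>F. norm (T t x - T t m) < e / bound"
    by blast
  have "pnorm z < e" if "norm z < e / bound" for z
    using pnorm_le[of z] that bound_ge_1 by (simp add: pos_less_divide_eq mult.commute)
  with F(3) have "\<exists>m\<in>F. pnorm (T t x - T t m) < e" if "\<bar>x\<bar> \<le> y" for x using that by meson
  with F(1,2) show ?thesis by blast
qed

text \<open>For finitely many centres a common \<open>r\<close> exists, as \<open>pnorm\<close>
  decreases along orbits. Passing between \<open>x\<close> and its centre costs one third of
  \<open>e\<close> in \<open>pnorm\<close> and another in \<open>qnorm\<close>.\<close>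

lemma pnorm_uniform:
  assumes "e > 0" obtains r where "\<And>x. \<bar>x\<bar> \<le> y \<Longrightarrow> pnorm (T r x) \<le> qnorm x + e"
proof -
  have e3: "e / 3 > 0" using assms by simp
  obtain F t where F: "finite F" "\<And>m. m \<in> F \<Longrightarrow> \<bar>m\<bar> \<le> y"
    "\<And>x. \<bar>x\<bar> \<le> y \<Longrightarrow> \<exists>m\<in>F. pnorm (T t x - T t m) < e / 3"
    using finite_net_pnorm[OF e3] by blast
  have "\<exists>r. \<forall>m\<in>G. pnorm (T (t + r) m) \<le> qnorm m + e / 3" if "finite G" for G
    using that
  proof induction
    case (insert g G)
    then obtain r where r: "\<forall>m\<in>G. pnorm (T (t + r) m) \<le> qnorm m + e / 3" by blast
    obtain r' where r': "pnorm (T r' g) < qnorm g + e / 3" using qnorm_approx[OF e3] .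
    have "pnorm (T (t + (r + r')) g) \<le> qnorm g + e / 3"
      using pnorm_T_add_le[of r' "t + r" g] r' by (simp add: add.commute add.left_commute)
    moreover have "pnorm (T (t + (r + r')) m) \<le> qnorm m + e / 3" if "m \<in> G" for m
      using pnorm_T_add_le[of "t + r" r' m] r that by (fastforce simp: add.assoc)
    ultimately show ?case by blast
  qed simp
  from this[OF F(1)] obtain r where r: "\<And>m. m \<in> F \<Longrightarrow> pnorm (T (t + r) m) \<le> qnorm m + e / 3"
    by blast
  have "pnorm (T (t + r) x) \<le> qnorm x + e" if x: "\<bar>x\<bar> \<le> y" for x
  proof -
    obtain m where m: "m \<in> F" "pnorm (T t x - T t m) < e / 3" using F(3)[OF x] by blast
    have d: "pnorm (T (t + r) (x - m)) < e / 3"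
      using pnorm_T_add_le[of t r "x - m"] m(2) by (simp add: blinfun.diff_right)
    have "qnorm (m - x) \<le> pnorm (T (t + r) (m - x))" by (rule qnorm_le)
    also have "\<dots> = pnorm (T (t + r) (x - m))"
      using pnorm_minus[of "T (t + r) (x - m)"] by (simp flip: blinfun.minus_right)
    finally have "qnorm m \<le> qnorm x + e / 3"
      using qnorm_triangle[of x "m - x"] d by simp
    moreover have "pnorm (T (t + r) x) \<le> pnorm (T (t + r) (x - m)) + pnorm (T (t + r) m)"
      using pnorm_triangle[of "T (t + r) (x - m)" "T (t + r) m"] by (simp flip: blinfun.add_right)
    ultimately show ?thesis using r[OF m(1)] d by simp
  qed
  then show thesis by (rule that)
qed

text \<open>Pigeonhole: up to the net, each multiple of \<open>s + s\<close> acts on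
  \<open>F\<close> as one of finitely many maps from \<open>F\<close> to itself. Where two multiples
  agree, the earlier one cancels because \<open>qnorm\<close> is invariant. The same
  \<open>b\<close> serves all \<open>x\<close>.\<close>

lemma recurrence:
  assumes "e > 0" obtains b where "\<And>x. \<bar>x\<bar> \<le> y \<Longrightarrow> qnorm (T (s + b) x - x) \<le> e"
proof -
  have e4: "e / 4 > 0" using assms by simp
  obtain F t where F: "finite F" "\<And>m. m \<in> F \<Longrightarrow> \<bar>m\<bar> \<le> y"
    "\<And>x. \<bar>x\<bar> \<le> y \<Longrightarrow> \<exists>m\<in>F. pnorm (T t x - T t m) < e / 4"
    using finite_net_pnorm[OF e4] by blast
  have F': "\<exists>m\<in>F. qnorm (x - m) \<le> e / 4" if "\<bar>x\<bar> \<le> y" for x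
    using F(3)[OF that] qnorm_le[of "x - _" t]
    by (metis blinfun.diff_right less_imp_le order_trans)
  define near where "near x = (SOME m. m \<in> F \<and> qnorm (x - m) \<le> e / 4)" for x
  have near: "near x \<in> F \<and> qnorm (x - near x) \<le> e / 4" if "\<bar>x\<bar> \<le> y" for x
    unfolding near_def by (rule someI_ex) (use F'[OF that] in blast)
  define \<phi> where "\<phi> k = (\<lambda>m\<in>F. near (T (multiple (s + s) k) m))" for k
  have "range \<phi> \<subseteq> (\<Pi>\<^sub>E m\<in>F. F)"
    using near F(2) T_abs_le_y by (auto simp: \<phi>_def)
  then have "finite (range \<phi>)"
    by (rule finite_subset) (simp add: finite_PiE F(1))
  then have "\<not> inj \<phi>" using finite_imageD by blast
  then obtain i j where ij: "i < j" "\<phi> i = \<phi> j"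
    unfolding inj_def by (metis linorder_neqE_nat)
  \<comment> \<open>The index is one less than the difference, since \<open>multiple t n\<close> is
    \<open>n + 1\<close> times \<open>t\<close>.\<close>
  define a where "a = multiple (s + s) (j - i - 1)"
  have j: "multiple (s + s) j = multiple (s + s) i + a"
    using multiple_add[of "s + s" i "j - i - 1"] ij by (simp add: a_def)
  have Fa: "qnorm (T a m - m) \<le> e / 2" if m: "m \<in> F" for m
  proof -
    let ?Ti = "T (multiple (s + s) i)" and ?Tj = "T (multiple (s + s) j)"
    have "near (?Ti m) = near (?Tj m)"
      using fun_cong[OF ij(2), of m] m by (simp add: \<phi>_def)
    then have "qnorm (?Ti m - near (?Ti m)) \<le> e / 4" "qnorm (?Tj m - near (?Ti m)) \<le> e / 4"
      using near T_abs_le_y F(2)[OF m] by metis+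
    then have "qnorm (?Tj m - ?Ti m) \<le> e / 2"
      using qnorm_triangle_diff[of "?Tj m - near (?Ti m)" "?Ti m - near (?Ti m)"] by simp
    then show ?thesis
      unfolding j T_add by (simp add: qnorm_T flip: blinfun.diff_right)
  qed
  obtain b where b: "a = s + b" unfolding a_def using multiple_double by blast
  have "qnorm (T (s + b) x - x) \<le> e" if x: "\<bar>x\<bar> \<le> y" for x
  proof -
    obtain m where m: "m \<in> F" "qnorm (x - m) \<le> e / 4" using F'[OF x] by blast
    have "T a x - x = (T a (x - m) - (x - m)) + (T a m - m)" by (simp add: blinfun.diff_right)
    then have "qnorm (T a x - x) \<le> qnorm (T a (x - m) - (x - m)) + qnorm (T a m - m)"
      using qnorm_triangle by metis
    also have "qnorm (T a (x - m) - (x - m)) \<le> qnorm (x - m) + qnorm (x - m)"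
      using qnorm_triangle_diff[of "T a (x - m)" "x - m"] by (simp add: qnorm_T)
    finally show ?thesis using m Fa[OF m(1)] unfolding b by simp
  qed
  then show thesis by (rule that)
qed

lemma pnorm_uniform_scaled:
  assumes r: "\<And>x. \<bar>x\<bar> \<le> y \<Longrightarrow> pnorm (T r x) \<le> qnorm x + e"
    and x: "c > 0" "\<bar>x\<bar> \<le> c *\<^sub>R y"
  shows "pnorm (T r x) \<le> qnorm x + c * e"
proof -
  have "pnorm (T r x) = c * pnorm (T r ((1 / c) *\<^sub>R x))"
    using x(1) by (simp add: blinfun.scaleR_right pnorm_scaleR)
  also have "\<dots> \<le> c * (qnorm ((1 / c) *\<^sub>R x) + e)"
    using r[OF abs_scaleR_inverse_le[OF x]] x(1) by simp
  also have "\<dots> \<le> c * (1 / c * qnorm x + e)"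
    using qnorm_scaleR_le[of "1 / c" x] x(1) by simp
  finally show ?thesis using x(1) by (simp add: distrib_left)
qed

text \<open>Recurrence is applied with \<open>s = r n\<close>, so that
  \<open>a n = r n + b n\<close> is late enough for the uniform estimate and at the same time almost
  the identity for \<open>qnorm\<close>.\<close>

lemma ex_approximating_sequence:
  "\<exists>a. \<exists>r b. \<forall>n. a n = r n + b n \<and>
    (\<forall>x. \<bar>x\<bar> \<le> y \<longrightarrow> pnorm (T (r n) x) \<le> qnorm x + inverse (real (Suc n))) \<and>
    (\<forall>x. \<bar>x\<bar> \<le> y \<longrightarrow> qnorm (T (a n) x - x) \<le> inverse (real (Suc n)))"
proof -
  have "\<exists>a r b. a = r + b \<and>
    (\<forall>x. \<bar>x\<bar> \<le> y \<longrightarrow> pnorm (T r x) \<le> qnorm x + inverse (real (Suc n))) \<and>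
    (\<forall>x. \<bar>x\<bar> \<le> y \<longrightarrow> qnorm (T a x - x) \<le> inverse (real (Suc n)))" for n
  proof -
    have pos: "inverse (real (Suc n)) > 0" by simp
    obtain r where "\<forall>x. \<bar>x\<bar> \<le> y \<longrightarrow> pnorm (T r x) \<le> qnorm x + inverse (real (Suc n))"
      using pnorm_uniform[OF pos] by blast
    moreover obtain b where "\<forall>x. \<bar>x\<bar> \<le> y \<longrightarrow> qnorm (T (r + b) x - x) \<le> inverse (real (Suc n))"
      using recurrence[OF pos] by blast
    ultimately show ?thesis by blast
  qed
  then show ?thesis by metis
qed

text \<open>Along this sequence the operators converge, on the principal ideal of \<open>y\<close>,
  to the Jacobs--de Leeuw--Glicksberg projection.\<close>

definition aseq :: "nat \<Rightarrow> 's" where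
  "aseq = (SOME a. \<exists>r b. \<forall>n. a n = r n + b n \<and>
    (\<forall>x. \<bar>x\<bar> \<le> y \<longrightarrow> pnorm (T (r n) x) \<le> qnorm x + inverse (real (Suc n))) \<and>
    (\<forall>x. \<bar>x\<bar> \<le> y \<longrightarrow> qnorm (T (a n) x - x) \<le> inverse (real (Suc n))))"

lemma qnorm_aseq: "\<bar>x\<bar> \<le> y \<Longrightarrow> qnorm (T (aseq n) x - x) \<le> inverse (real (Suc n))"
  using someI_ex[OF ex_approximating_sequence] unfolding aseq_def[symmetric] by blast

lemma pnorm_aseq:
  assumes "c > 0" "\<bar>x\<bar> \<le> c *\<^sub>R y"
  shows "pnorm (T (aseq n) x) \<le> qnorm x + c * inverse (real (Suc n))"
proof -
  obtain r b where a: "aseq n = r + b"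
    and r: "\<And>x. \<bar>x\<bar> \<le> y \<Longrightarrow> pnorm (T r x) \<le> qnorm x + inverse (real (Suc n))"
    using someI_ex[OF ex_approximating_sequence] unfolding aseq_def[symmetric] by blast
  have "pnorm (T (aseq n) x) \<le> pnorm (T r x)" unfolding a by (rule pnorm_T_add_le)
  also have "\<dots> \<le> qnorm x + c * inverse (real (Suc n))"
    by (rule pnorm_uniform_scaled[OF r assms])
  finally show ?thesis .
qed

section \<open>Reversible vectors and their compact order intervals\<close>

definition reversible :: "'a set" where
  "reversible = {x. (\<lambda>n. T (aseq n) x) \<longlonglongrightarrow> x}"

lemma inverse_Suc_small:
  assumes "(e::real) > 0" obtains N where "\<And>n. n \<ge> N \<Longrightarrow> inverse (real (Suc n)) < e"
  using LIMSEQ_D[OF LIMSEQ_inverse_real_of_nat assms] that by auto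

lemma tendsto_zero_aseq:
  assumes "c > 0" "\<bar>x\<bar> \<le> c *\<^sub>R y" "qnorm x = 0" shows "(\<lambda>n. T (aseq n) x) \<longlonglongrightarrow> 0"
proof (rule LIMSEQ_norm_diff_le)
  show "norm (T (aseq n) x - 0) \<le> c * inverse (real (Suc n))" for n
    using norm_le_pnorm[of "T (aseq n) x"] pnorm_aseq[OF assms(1,2), of n] assms(3) by simp
  show "(\<lambda>n. c * inverse (real (Suc n))) \<longlonglongrightarrow> 0"
    using tendsto_mult_right_zero[OF LIMSEQ_inverse_real_of_nat, of c] .
qed

lemma reversible_part_aux:
  assumes x: "\<bar>x\<bar> \<le> y"
  shows "\<exists>w\<in>reversible. \<bar>w\<bar> \<le> y \<and> qnorm (x - w) = 0"
proof -
  define a where "a = aseq"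
  have two: "\<bar>u - v\<bar> \<le> 2 *\<^sub>R y" if "\<bar>u\<bar> \<le> y" "\<bar>v\<bar> \<le> y" for u v
    using abs_triangle_ineq4[of u v] add_mono[OF that] by (simp add: scaleR_2)
  \<comment> \<open>The comparison vector is symmetric in \<open>n\<close> and \<open>m\<close>, so
    two such steps join \<open>T (a n) x\<close> to \<open>T (a m) x\<close>. Each costs three
    units, one by recurrence and two because \<open>x - T (a m) x\<close> lies in
    \<open>[-2y, 2y]\<close>; hence \<open>e / 6\<close> below.\<close>
  have step: "norm (T (a n) x - T (a n + a m) x) \<le> inverse (real (Suc m)) + 2 * inverse (real (Suc n))"
    for n m
  proof -
    have le: "\<bar>x - T (a m) x\<bar> \<le> 2 *\<^sub>R y" using x T_abs_le_y[OF x] by (rule two)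
    have "norm (T (a n) x - T (a n + a m) x) \<le> pnorm (T (a n) (x - T (a m) x))"
      unfolding T_add blinfun.diff_right by (rule norm_le_pnorm)
    also have "\<dots> \<le> qnorm (x - T (a m) x) + 2 * inverse (real (Suc n))"
      unfolding a_def by (rule pnorm_aseq) (use le in \<open>simp_all add: a_def\<close>)
    also have "qnorm (x - T (a m) x) \<le> inverse (real (Suc m))"
      using qnorm_aseq[OF x, of m] qnorm_minus[of "x - T (a m) x"] by (simp add: a_def)
    finally show ?thesis by simp
  qed
  have "Cauchy (\<lambda>n. T (a n) x)"
  proof (rule metric_CauchyI)
    fix e :: real assume "e > 0"
    then have "e / 6 > 0" by simp
    then obtain N where N: "\<And>n. n \<ge> N \<Longrightarrow> inverse (real (Suc n)) < e / 6"
      using inverse_Suc_small by blast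
    show "\<exists>M. \<forall>m\<ge>M. \<forall>n\<ge>M. dist (T (a m) x) (T (a n) x) < e"
    proof (intro exI[of _ N] allI impI)
      fix m n assume "m \<ge> N" "n \<ge> N"
      have "norm (T (a m) x - T (a n) x)
          \<le> norm (T (a m) x - T (a m + a n) x) + norm (T (a n) x - T (a n + a m) x)"
        using norm_triangle_ineq4[of "T (a m) x - T (a m + a n) x" "T (a n) x - T (a n + a m) x"]
        by (simp add: add.commute)
      then show "dist (T (a m) x) (T (a n) x) < e"
        using step[of m n] step[of n m] N[OF \<open>m \<ge> N\<close>] N[OF \<open>n \<ge> N\<close>] by (simp add: dist_norm)
    qed
  qed
  then obtain w where w: "(\<lambda>n. T (a n) x) \<longlonglongrightarrow> w"
    by (auto simp: Cauchy_convergent_iff convergent_def)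
  have wy: "\<bar>w\<bar> \<le> y"
    by (rule tendsto_le_lattice[OF tendsto_abs_lattice[OF w] tendsto_const])
      (rule T_abs_le_y[OF x])
  have q0: "qnorm (x - w) = 0"
  proof (rule antisym[OF LIMSEQ_le_const qnorm_nonneg])
    have "(\<lambda>n. bound * norm (T (a n) x - w)) \<longlonglongrightarrow> bound * norm (w - w)"
      by (intro tendsto_intros w)
    then show "(\<lambda>n. inverse (real (Suc n)) + bound * norm (T (a n) x - w)) \<longlonglongrightarrow> 0"
      using tendsto_add[OF LIMSEQ_inverse_real_of_nat] by fastforce
    have "qnorm (x - w) \<le> inverse (real (Suc n)) + bound * norm (T (a n) x - w)" for n
      using qnorm_triangle_diff[of "T (a n) x - w" "T (a n) x - x"] qnorm_aseq[OF x, of n]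
        qnorm_le_norm[of "T (a n) x - w"] by (simp add: a_def)
    then show "\<exists>N. \<forall>n\<ge>N. qnorm (x - w) \<le> inverse (real (Suc n)) + bound * norm (T (a n) x - w)"
      by blast
  qed
  \<comment> \<open>The difference \<open>x - w\<close> is lost in the limit, so \<open>w\<close>
    has the same limit along the sequence as \<open>x\<close>, namely \<open>w\<close>
    itself.\<close>
  have "(\<lambda>n. T (a n) (x - w)) \<longlonglongrightarrow> 0"
    unfolding a_def by (rule tendsto_zero_aseq[OF _ two[OF x wy] q0]) simp
  from tendsto_diff[OF w this] have "w \<in> reversible"
    by (simp add: reversible_def a_def blinfun.diff_right)
  with wy q0 show ?thesis by blast
qed

definition L :: "'a set" where
  "L = reversible \<inter> principal_ideal y"

lemma L_bounded:
  assumes "x \<in> L" obtains c where "c > 0" "\<bar>x\<bar> \<le> c *\<^sub>R y"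
  using principal_ideal_pos_bound[OF _ y_nonneg, of x] assms unfolding L_def by blast

lemma abs_le_imp_principal_ideal: "\<bar>x\<bar> \<le> y \<Longrightarrow> x \<in> principal_ideal y"
  unfolding principal_ideal_def by (auto intro!: exI[of _ 1])

lemma subspace_L: "subspace L"
proof -
  have "subspace reversible"
  proof (rule subspaceI)
    show "u + v \<in> reversible" if "u \<in> reversible" "v \<in> reversible" for u v
      using that unfolding reversible_def mem_Collect_eq blinfun.add_right by (rule tendsto_add)
    show "c *\<^sub>R u \<in> reversible" if "u \<in> reversible" for c u
      using that unfolding reversible_def mem_Collect_eq blinfun.scaleR_right
      by (intro tendsto_intros)
  qed (simp add: reversible_def blinfun.zero_right)
  then show ?thesis
    unfolding L_def by (rule subspace_inter[OF _ subspace_principal_ideal[OF y_nonneg]])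
qed

lemma reversible_part:
  assumes "x \<in> principal_ideal y" shows "\<exists>w\<in>L. qnorm (x - w) = 0"
proof -
  obtain c where c: "c > 0" "\<bar>x\<bar> \<le> c *\<^sub>R y"
    using principal_ideal_pos_bound[OF assms y_nonneg] .
  obtain w where w: "w \<in> reversible" "\<bar>w\<bar> \<le> y" "qnorm ((1 / c) *\<^sub>R x - w) = 0"
    using reversible_part_aux[OF abs_scaleR_inverse_le[OF c]] by blast
  have "w \<in> L" using w(1,2) abs_le_imp_principal_ideal by (simp add: L_def)
  then have "c *\<^sub>R w \<in> L" by (rule subspace_scale[OF subspace_L])
  moreover have "x - c *\<^sub>R w = c *\<^sub>R ((1 / c) *\<^sub>R x - w)"
    using c(1) by (simp add: scaleR_diff_right)
  then have "qnorm (x - c *\<^sub>R w) = 0"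
    using qnorm_scaleR_le[of c "(1 / c) *\<^sub>R x - w"] qnorm_nonneg[of "x - c *\<^sub>R w"] w(3) by simp
  ultimately show ?thesis by blast
qed

lemma T_in_L: "x \<in> L \<Longrightarrow> T t x \<in> L"
proof -
  assume x: "x \<in> L"
  have "(\<lambda>n. T t (T (aseq n) x)) \<longlonglongrightarrow> T t x"
    using x by (intro tendsto_intros) (simp add: L_def reversible_def)
  then have "T t x \<in> reversible" by (simp add: reversible_def T_commute[of _ t])
  moreover have "T t x \<in> principal_ideal y"
    using x T_abs_le unfolding L_def principal_ideal_def by blast
  ultimately show ?thesis by (simp add: L_def)
qed

text \<open>By \<open>pnorm_aseq\<close> the vectors \<open>T (aseq n) x\<close> have nearly the
  norm \<open>qnorm x\<close>, and on \<open>L\<close> they return to \<open>x\<close>. So no orbit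
  in \<open>L\<close> loses norm.\<close>

lemma pnorm_eq_qnorm:
  assumes "x \<in> L" shows "pnorm x = qnorm x"
proof -
  obtain c where c: "c > 0" "\<bar>x\<bar> \<le> c *\<^sub>R y"
    using L_bounded[OF assms] .
  have lim: "(\<lambda>n. T (aseq n) x) \<longlonglongrightarrow> x" using assms by (simp add: L_def reversible_def)
  have "(\<lambda>n. qnorm x + c * inverse (real (Suc n)) + bound * norm (x - T (aseq n) x))
      \<longlonglongrightarrow> qnorm x + c * 0 + bound * norm (x - x)"
    by (intro tendsto_intros lim LIMSEQ_inverse_real_of_nat)
  then have "(\<lambda>n. qnorm x + c * inverse (real (Suc n)) + bound * norm (x - T (aseq n) x)) \<longlonglongrightarrow> qnorm x"
    by simp
  moreover have "pnorm x \<le> qnorm x + c * inverse (real (Suc n)) + bound * norm (x - T (aseq n) x)" for n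
    using pnorm_triangle[of "T (aseq n) x" "x - T (aseq n) x"] pnorm_aseq[OF c, of n]
      pnorm_le[of "x - T (aseq n) x"] by simp
  ultimately have "pnorm x \<le> qnorm x"
    by (intro LIMSEQ_le_const) blast+
  then show ?thesis using qnorm_le_pnorm[of x] by simp
qed

lemma pnorm_T: "x \<in> L \<Longrightarrow> pnorm (T t x) = pnorm x"
  by (simp add: pnorm_eq_qnorm T_in_L qnorm_T)

text \<open>On \<open>L\<close> the norm is dominated by \<open>pnorm = qnorm\<close>, so recurrence
  holds in norm, at an index beyond any given \<open>s\<close>.\<close>

lemma L_recurrent:
  assumes x: "x \<in> L" and e: "e > 0"
  obtains b where "norm (T (s + b) x - x) \<le> e"
proof -
  obtain c where c: "c > 0" "\<bar>x\<bar> \<le> c *\<^sub>R y"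
    using L_bounded[OF x] .
  have "e / c > 0" using c(1) e by simp
  from recurrence[OF this] obtain b where b: "\<And>x. \<bar>x\<bar> \<le> y \<Longrightarrow> qnorm (T (s + b) x - x) \<le> e / c"
    by blast
  define z where "z = (1 / c) *\<^sub>R x"
  have zL: "z \<in> L" unfolding z_def by (rule subspace_scale[OF subspace_L x])
  have dL: "T (s + b) z - z \<in> L" by (rule subspace_diff[OF subspace_L T_in_L[OF zL] zL])
  have "norm (T (s + b) z - z) \<le> qnorm (T (s + b) z - z)"
    using norm_le_pnorm[of "T (s + b) z - z"] unfolding pnorm_eq_qnorm[OF dL] .
  also have "\<dots> \<le> e / c" unfolding z_def by (rule b[OF abs_scaleR_inverse_le[OF c]])
  finally have le: "norm (T (s + b) z - z) \<le> e / c" .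
  have "T (s + b) x - x = c *\<^sub>R (T (s + b) z - z)"
    using c(1) by (simp add: z_def blinfun.scaleR_right scaleR_diff_right)
  then have "norm (T (s + b) x - x) = c * norm (T (s + b) z - z)" using c(1) by simp
  also have "\<dots> \<le> c * (e / c)" using le c(1) by (intro mult_left_mono) auto
  also have "\<dots> = e" using c(1) by simp
  finally show thesis by (rule that)
qed

lemma closed_reversible: "closed reversible"
  unfolding closed_sequential_limits
proof (intro allI impI, elim conjE)
  fix X x assume X: "\<forall>k. X k \<in> reversible" and lim: "X \<longlonglongrightarrow> x"
  have "\<exists>N. \<forall>n\<ge>N. norm (T (aseq n) x - x) < e" if "e > 0" for e
  proof -
    have pos: "e / (3 * bound) > 0" "e / 3 > 0" using that bound_ge_1 by simp_all
    obtain k where k: "norm (X k - x) < e / (3 * bound)" using LIMSEQ_D[OF lim pos(1)] by blast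
    have "(\<lambda>n. T (aseq n) (X k)) \<longlonglongrightarrow> X k" using X by (simp add: reversible_def)
    from LIMSEQ_D[OF this pos(2)] obtain N
      where N: "\<And>n. n \<ge> N \<Longrightarrow> norm (T (aseq n) (X k) - X k) < e / 3" by blast
    have bk: "bound * norm (X k - x) < e / 3"
      using k bound_ge_1 by (simp add: field_simps)
    have k': "norm (X k - x) < e / 3"
      using mult_right_mono[OF bound_ge_1, of "norm (X k - x)"] bk by simp
    have "norm (T (aseq n) x - x) < e" if "n \<ge> N" for n
    proof -
      have "T (aseq n) x - x = (T (aseq n) (X k) - X k) + (X k - x) - T (aseq n) (X k - x)"
        by (simp add: blinfun.diff_right)
      then have "norm (T (aseq n) x - x)
          = norm ((T (aseq n) (X k) - X k) + (X k - x) - T (aseq n) (X k - x))"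
        by (rule arg_cong)
      also have "\<dots> \<le> norm ((T (aseq n) (X k) - X k) + (X k - x)) + norm (T (aseq n) (X k - x))"
        by (rule norm_triangle_ineq4)
      also have "\<dots> \<le> (norm (T (aseq n) (X k) - X k) + norm (X k - x)) + norm (T (aseq n) (X k - x))"
        by (intro add_right_mono norm_triangle_ineq)
      finally have "norm (T (aseq n) x - x)
        \<le> norm (T (aseq n) (X k) - X k) + norm (X k - x) + norm (T (aseq n) (X k - x))" .
      then show ?thesis
        using N[OF that] k' bk norm_T_apply_le[of "aseq n" "X k - x"] by linarith
    qed
    then show ?thesis by blast
  qed
  then show "x \<in> reversible" unfolding reversible_def mem_Collect_eq by (intro LIMSEQ_I)
qed

text \<open>The net of \<open>finite_net\<close> covers only images under \<open>T t\<close>;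
  recurrence shows that every \<open>x\<close> in \<open>L\<close> is nearly such an image, namely
  of \<open>T b x\<close>.\<close>

lemma compact_L_unit: "compact {x\<in>L. \<bar>x\<bar> \<le> y}"
proof -
  have eq: "{x\<in>L. \<bar>x\<bar> \<le> y} = reversible \<inter> {x. \<bar>x\<bar> \<le> y}"
    using abs_le_imp_principal_ideal by (auto simp: L_def)
  have "complete {x\<in>L. \<bar>x\<bar> \<le> y}"
    unfolding eq complete_eq_closed by (intro closed_Int closed_reversible closed_abs_le)
  moreover have "\<exists>k. finite k \<and> {x\<in>L. \<bar>x\<bar> \<le> y} \<subseteq> (\<Union>x\<in>k. ball x e)" if e: "e > 0" for e
  proof -
    have "e / 2 > 0" using e by simp
    from finite_net[OF this] obtain t F where F: "finite F"
      "\<And>x. \<bar>x\<bar> \<le> y \<Longrightarrow> \<exists>m\<in>F. norm (T t x - T t m) < e / 2" by blast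
    have "\<exists>m\<in>T t ` F. dist m x < e" if x: "x \<in> L" "\<bar>x\<bar> \<le> y" for x
    proof -
      obtain b where b: "norm (T (t + b) x - x) \<le> e / 2"
        using L_recurrent[OF x(1) \<open>e / 2 > 0\<close>] .
      obtain m where m: "m \<in> F" "norm (T t (T b x) - T t m) < e / 2"
        using F(2)[OF T_abs_le_y[OF x(2)]] by blast
      have "norm (T t m - x) \<le> norm (T (t + b) x - x) + norm (T t (T b x) - T t m)"
        using norm_triangle_ineq4[of "T (t + b) x - x" "T t (T b x) - T t m"] by (simp add: T_add)
      then have "dist (T t m) x < e" using b m(2) by (simp add: dist_norm)
      then show ?thesis using m(1) by blast
    qed
    then have "{x\<in>L. \<bar>x\<bar> \<le> y} \<subseteq> (\<Union>m\<in>T t ` F. ball m e)" by fastforce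
    then show ?thesis using F(1) by blast
  qed
  ultimately show ?thesis unfolding compact_eq_totally_bounded by blast
qed

lemma compact_L: "compact {x\<in>L. \<bar>x\<bar> \<le> c *\<^sub>R y}" if c: "c > 0"
proof -
  have "{x\<in>L. \<bar>x\<bar> \<le> c *\<^sub>R y} = (\<lambda>x. c *\<^sub>R x) ` {x\<in>L. \<bar>x\<bar> \<le> y}"
  proof (intro equalityI subsetI)
    fix x assume x: "x \<in> {x\<in>L. \<bar>x\<bar> \<le> c *\<^sub>R y}"
    have "(1 / c) *\<^sub>R x \<in> {x\<in>L. \<bar>x\<bar> \<le> y}"
      using x abs_scaleR_inverse_le[OF c, of x y] subspace_scale[OF subspace_L, of x "1 / c"]
      by simp
    then show "x \<in> (\<lambda>x. c *\<^sub>R x) ` {x\<in>L. \<bar>x\<bar> \<le> y}"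
      using c by (intro image_eqI[of _ _ "(1 / c) *\<^sub>R x"]) (simp, assumption)
  next
    fix x assume "x \<in> (\<lambda>x. c *\<^sub>R x) ` {x\<in>L. \<bar>x\<bar> \<le> y}"
    then show "x \<in> {x\<in>L. \<bar>x\<bar> \<le> c *\<^sub>R y}"
      using c subspace_scale[OF subspace_L]
      by (auto simp: abs_scaleR_lattice intro!: scaleR_left_mono)
  qed
  then show ?thesis using compact_scaling[OF compact_L_unit] by simp
qed

text \<open>By recurrence \<open>x\<close> is a limit of vectors \<open>T (b n) (T t x)\<close>: the
  inverse of \<open>T t\<close> on \<open>L\<close> is approximated by positive operators.\<close>

lemma T_reflects_nonneg:
  assumes x: "x \<in> L" and nn: "0 \<le> T t x" shows "0 \<le> x"
proof -
  have "\<exists>b. norm (T (t + b) x - x) \<le> inverse (real (Suc n))" for n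
    using L_recurrent[OF x, of "inverse (real (Suc n))" t] by auto
  then obtain b where b: "\<And>n. norm (T (t + b n) x - x) \<le> inverse (real (Suc n))" by metis
  have "(\<lambda>n. T (t + b n) x) \<longlonglongrightarrow> x"
    by (rule LIMSEQ_norm_diff_le[OF b LIMSEQ_inverse_real_of_nat])
  moreover have "0 \<le> T (t + b n) x" for n
    unfolding T_add T_commute[of t] by (rule T_nonneg[OF nn])
  ultimately show ?thesis by (rule tendsto_nonneg_lattice)
qed

text \<open>The image of a compact order interval is closed, and it contains the vectors
  \<open>T t (T b x)\<close>, which come arbitrarily close to \<open>x\<close>.\<close>

lemma T_surj_L:
  assumes x: "x \<in> L" shows "\<exists>v\<in>L. T t v = x"
proof -
  obtain c where c: "c > 0" "\<bar>x\<bar> \<le> c *\<^sub>R y"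
    using L_bounded[OF x] .
  let ?B = "{x\<in>L. \<bar>x\<bar> \<le> c *\<^sub>R y}"
  have "compact (T t ` ?B)"
    by (intro compact_continuous_image compact_L c linear_continuous_on blinfun.bounded_linear_right)
  then have "closed (T t ` ?B)" by (rule compact_imp_closed)
  moreover have "\<exists>z\<in>T t ` ?B. dist z x < e" if e: "e > 0" for e
  proof -
    have "e / 2 > 0" using e by simp
    from L_recurrent[OF x this] obtain b where b: "norm (T (t + b) x - x) \<le> e / 2" .
    have "T b x \<in> ?B" using T_in_L[OF x] T_abs_le[OF c(2)] by simp
    moreover have "dist (T t (T b x)) x < e" using b e by (simp add: dist_norm T_add)
    ultimately show ?thesis by blast
  qed
  ultimately have "x \<in> T t ` ?B" using closed_approachable by blast
  then show ?thesis by blast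
qed

section \<open>Null orbits and the lattice structure of \<open>L\<close>\<close>

lemma tendsto_zero_semigroup_at_top:
  assumes "qnorm x = 0" shows "((\<lambda>t. T t x) \<longlongrightarrow> 0) semigroup_at_top"
proof (rule tendstoI)
  fix e :: real assume "e > 0"
  then obtain s where s: "pnorm (T s x) < e" using qnorm_approx[of e x] assms by auto
  have "norm (T t x) < e" if "semigroup_le s t" for t
  proof -
    have "pnorm (T t x) \<le> pnorm (T s x)"
      using that pnorm_T_add_le by (auto simp: semigroup_le_def)
    then show ?thesis using norm_le_pnorm[of "T t x"] s by linarith
  qed
  then show "\<forall>\<^sub>F t in semigroup_at_top. dist (T t x) 0 < e"
    unfolding eventually_semigroup_at_top by auto
qed

text \<open>Order continuity provides a largest null vector \<open>u\<close> in
  \<open>[0, y]\<close>. Maximality gives \<open>T t u <= u\<close>, so \<open>y - u\<close> is a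
  super fixed point and therefore fixed; then \<open>u\<close> is fixed as well, and a fixed null
  vector is zero.\<close>

lemma qnorm_eq_zero_nonneg:
  assumes oc: "order_continuous_norm TYPE('a)"
    and super: "\<And>x. super_fixed_point T x \<Longrightarrow> fixed_point T x"
    and x: "0 \<le> x" "x \<le> y" "qnorm x = 0"
  shows "x = 0"
proof -
  \<comment> \<open>Complements in \<open>y\<close> turn the upward directed set of null vectors
    into a downward directed one.\<close>
  define D where "D = {y - u | u. 0 \<le> u \<and> u \<le> y \<and> qnorm u = 0}"
  have ne: "D \<noteq> {}" using x by (auto simp: D_def)
  have dir: "\<exists>z\<in>D. z \<le> a \<and> z \<le> b" if ab: "a \<in> D" "b \<in> D" for a b
  proof -
    obtain u v where uv: "a = y - u" "b = y - v" "0 \<le> u" "0 \<le> v" "u \<le> y" "v \<le> y"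
      "qnorm u = 0" "qnorm v = 0"
      using ab unfolding D_def by auto
    have "0 \<le> sup u v" using uv by (simp add: le_supI1)
    moreover have "sup u v \<le> u + v" using uv by (intro sup_least) simp_all
    ultimately have "qnorm (sup u v) \<le> qnorm (u + v)" by (rule qnorm_mono)
    then have "qnorm (sup u v) = 0"
      using qnorm_triangle[of u v] uv qnorm_nonneg[of "sup u v"] by simp
    then have "y - sup u v \<in> D" using uv \<open>0 \<le> sup u v\<close> by (auto simp: D_def)
    then show ?thesis using uv by (intro bexI[of _ "y - sup u v"]) (auto intro: diff_left_mono)
  qed
  obtain d z where d: "\<And>n::nat. d n \<in> D" "d \<longlonglongrightarrow> z" and z: "\<And>v. v \<in> D \<Longrightarrow> z \<le> v"
    by (rule order_continuous_norm_directed[OF oc ne dir, of 0]) (auto simp: D_def)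
  define u where "u = y - z"
  have du: "(\<lambda>n. y - d n) \<longlonglongrightarrow> u" unfolding u_def by (intro tendsto_intros d)
  have dn: "0 \<le> y - d n \<and> y - d n \<le> y \<and> qnorm (y - d n) = 0" for n
    using d(1)[of n] by (auto simp: D_def)
  have u: "0 \<le> u" "u \<le> y"
    using tendsto_nonneg_lattice[OF du] tendsto_le_lattice[OF du tendsto_const] dn by blast+
  have "qnorm u \<le> 0"
  proof (rule LIMSEQ_le_const)
    have "(\<lambda>n. bound * norm (u - (y - d n))) \<longlonglongrightarrow> bound * norm (u - u)"
      by (intro tendsto_intros du)
    then show "(\<lambda>n. bound * norm (u - (y - d n))) \<longlonglongrightarrow> 0" by simp
    have "qnorm u \<le> bound * norm (u - (y - d n))" for n
      using qnorm_triangle[of "u - (y - d n)" "y - d n"] dn[of n] qnorm_le_norm[of "u - (y - d n)"]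
      by simp
    then show "\<exists>N. \<forall>n\<ge>N. qnorm u \<le> bound * norm (u - (y - d n))" by blast
  qed
  then have q: "qnorm u = 0" using qnorm_nonneg[of u] by simp
  have max: "v \<le> u" if "0 \<le> v" "v \<le> y" "qnorm v = 0" for v
  proof -
    have "y - v \<in> D" using that by (auto simp: D_def)
    from z[OF this] show ?thesis by (simp add: u_def algebra_simps)
  qed
  have "T t u \<le> u" for t
    using T_nonneg[OF u(1)] T_mono[OF u(2), of t] T_y q by (intro max) (simp_all add: qnorm_T)
  then have "y - u \<le> T t (y - u)" for t by (simp add: blinfun.diff_right T_y diff_left_mono)
  then have "super_fixed_point T (y - u)" using u by (simp add: super_fixed_point_def)
  then have "T t (y - u) = y - u" for t using super by (auto simp: fixed_point_def)
  then have Tu: "T t u = u" for t by (simp add: blinfun.diff_right T_y)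
  have "pnorm u \<le> 0"
    using qnorm_greatest[of "pnorm u" u] q by (simp add: Tu)
  then have "norm u \<le> 0" using norm_le_pnorm[of u] by linarith
  then have "u = 0" by simp
  then show ?thesis using max[OF x] x(1) by simp
qed

text \<open>Let \<open>w\<close> be the reversible part of \<open>\<bar>u\<bar>\<close>. Positivity
  of the operators along \<open>aseq\<close> gives \<open>\<bar>u\<bar> \<le> w\<close> in the
  limit, and the difference is then a positive null vector, hence zero.\<close>

lemma abs_in_L:
  assumes oc: "order_continuous_norm TYPE('a)"
    and super: "\<And>x. super_fixed_point T x \<Longrightarrow> fixed_point T x"
    and x: "x \<in> L"
  shows "\<bar>x\<bar> \<in> L"
proof -
  obtain c where c: "c > 0" "\<bar>x\<bar> \<le> c *\<^sub>R y"
    using L_bounded[OF x] .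
  define u where "u = (1 / c) *\<^sub>R x"
  have uL: "u \<in> L" unfolding u_def by (rule subspace_scale[OF subspace_L x])
  have uy: "\<bar>u\<bar> \<le> y" unfolding u_def by (rule abs_scaleR_inverse_le[OF c])
  obtain w where w: "w \<in> L" "qnorm (\<bar>u\<bar> - w) = 0"
    using reversible_part[of "\<bar>u\<bar>"] abs_le_imp_principal_ideal[of "\<bar>u\<bar>"] uy by auto
  obtain d where d: "d > 0" "\<bar>w - \<bar>u\<bar>\<bar> \<le> d *\<^sub>R y"
  proof (rule principal_ideal_pos_bound[OF _ y_nonneg, of "w - \<bar>u\<bar>"])
    show "w - \<bar>u\<bar> \<in> principal_ideal y"
      using w(1) abs_le_imp_principal_ideal[of "\<bar>u\<bar>"] uy
      by (intro subspace_diff[OF subspace_principal_ideal[OF y_nonneg]]) (simp_all add: L_def)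
  qed blast
  have q: "qnorm (w - \<bar>u\<bar>) = 0" using w(2) qnorm_minus[of "w - \<bar>u\<bar>"] by simp
  have le: "\<bar>u\<bar> \<le> w"
  proof (rule tendsto_le_lattice)
    show "(\<lambda>n. \<bar>T (aseq n) u\<bar>) \<longlonglongrightarrow> \<bar>u\<bar>"
      using uL by (intro tendsto_abs_lattice) (simp add: L_def reversible_def)
    have "(\<lambda>n. T (aseq n) w - T (aseq n) (w - \<bar>u\<bar>)) \<longlonglongrightarrow> w - 0"
      using w(1) by (intro tendsto_diff tendsto_zero_aseq[OF d q]) (simp add: L_def reversible_def)
    then show "(\<lambda>n. T (aseq n) \<bar>u\<bar>) \<longlonglongrightarrow> w" by (simp add: blinfun.diff_right)
    show "\<bar>T (aseq n) u\<bar> \<le> T (aseq n) \<bar>u\<bar>" for n by (rule T_abs)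
  qed
  have "(1 / d) *\<^sub>R (w - \<bar>u\<bar>) = 0"
  proof (rule qnorm_eq_zero_nonneg[OF oc super])
    show "0 \<le> (1 / d) *\<^sub>R (w - \<bar>u\<bar>)" using d(1) le by (intro scaleR_nonneg_nonneg) simp_all
    show "(1 / d) *\<^sub>R (w - \<bar>u\<bar>) \<le> y"
      using abs_scaleR_inverse_le[OF d] abs_ge_self order_trans by blast
    show "qnorm ((1 / d) *\<^sub>R (w - \<bar>u\<bar>)) = 0"
      using qnorm_scaleR_le[of "1 / d" "w - \<bar>u\<bar>"] q qnorm_nonneg[of "(1 / d) *\<^sub>R (w - \<bar>u\<bar>)"] by simp
  qed
  then have "\<bar>u\<bar> = w" using d(1) by simp
  moreover have "\<bar>x\<bar> = c *\<^sub>R \<bar>u\<bar>" using c(1) by (simp add: u_def abs_scaleR_lattice)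
  ultimately show ?thesis using subspace_scale[OF subspace_L w(1), of c] by simp
qed

end

section \<open>Divisible groups and permutations of atoms\<close>

text \<open>Every cycle has length at most \<open>card X\<close>, which divides the factorial. The
  exponent depends on \<open>X\<close> alone, so it serves all operators at once.\<close>

lemma funpow_fact_card_eq:
  assumes X: "finite X" "g ` X \<subseteq> X" "inj_on g X" and x: "x \<in> X"
  shows "(g ^^ fact (card X)) x = x"
proof -
  have mem: "(g ^^ n) z \<in> X" if "z \<in> X" for n z
    using that X(2) by (induction n) auto
  have inj: "z = z'" if "(g ^^ n) z = (g ^^ n) z'" "z \<in> X" "z' \<in> X" for n z z'
    using that
  proof (induction n)
    case (Suc n)
    have "(g ^^ n) z = (g ^^ n) z'"
      using Suc.prems mem[of z n] mem[of z' n] inj_onD[OF X(3)] by simp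
    then show ?case using Suc by blast
  qed simp
  have "\<not> inj_on (\<lambda>n. (g ^^ n) x) {0..card X}"
  proof
    assume "inj_on (\<lambda>n. (g ^^ n) x) {0..card X}"
    then have "card {0..card X} \<le> card X"
      using mem[OF x] by (intro card_inj_on_le[OF _ _ X(1)]) auto
    then show False by simp
  qed
  then obtain i j where ij: "i < j" "j \<le> card X" "(g ^^ i) x = (g ^^ j) x"
    unfolding inj_on_def by (metis atLeastAtMost_iff linorder_neqE_nat)
  define k where "k = j - i"
  have k: "1 \<le> k" "k \<le> card X" using ij by (simp_all add: k_def)
  have "(g ^^ i) x = (g ^^ i) ((g ^^ k) x)"
    using ij by (simp add: k_def flip: funpow_add[unfolded o_def fun_eq_iff, rule_format])
  then have kx: "(g ^^ k) x = x" using inj mem x by metis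
  obtain m where m: "fact (card X) = k * m"
    using dvd_fact[OF k] by (auto simp: dvd_def)
  have "((g ^^ k) ^^ m) x = x" using kx by (induction m) simp_all
  then show ?thesis unfolding m by (simp add: funpow_mult mult.commute)
qed

lemma group_closure_range_diff:
  fixes \<iota> :: "'s::ab_semigroup_add \<Rightarrow> 'g::ab_group_add"
  assumes add: "\<And>s t. \<iota> (s + t) = \<iota> s + \<iota> t" and g: "g \<in> group_closure (range \<iota>)"
  shows "\<exists>a b. g = \<iota> a - \<iota> b"
  using g
proof induction
  case (base s)
  then consider "s = 0" | t where "s = \<iota> t" by auto
  then show ?case
  proof cases
    case 1
    then show ?thesis by (metis diff_self)
  next
    case 2
    then have "s = \<iota> (t + t) - \<iota> t" by (simp add: add)
    then show ?thesis by blast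
  qed
next
  case (diff s t)
  then obtain a b c d where "s = \<iota> a - \<iota> b" "t = \<iota> c - \<iota> d" by blast
  then have "s - t = \<iota> (a + d) - \<iota> (b + c)" by (simp add: add)
  then show ?case by blast
qed

text \<open>An \<open>(m + 1)\<close>-th part of \<open>\<iota> s\<close> is a difference
  \<open>\<iota> u - \<iota> v\<close>. Moving the negative term to the other side leaves an
  identity inside the semigroup, where the representation can be applied.\<close>

lemma divisible_group_multiple:
  fixes \<iota> :: "'s::ab_semigroup_add \<Rightarrow> 'g::ab_group_add" and s :: 's
  assumes gen: "generates_group \<iota>" and div: "divisible_group TYPE('g)"
  shows "\<exists>u v. s + multiple v m = multiple u m"
proof -
  have inj: "inj \<iota>" and add: "\<And>s t. \<iota> (s + t) = \<iota> s + \<iota> t"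
    and cl: "group_closure (range \<iota>) = UNIV"
    using gen by (auto simp: generates_group_def)
  obtain g where g: "(\<Sum>i<Suc m. g) = \<iota> s"
    using div unfolding divisible_group_def by (metis le_add1 plus_1_eq_Suc)
  obtain u v where uv: "g = \<iota> u - \<iota> v" using group_closure_range_diff[OF add, of g] cl by auto
  have mult: "(\<Sum>i<Suc m. \<iota> a) = \<iota> (multiple a m)" for a
    by (induction m) (simp_all add: add add.commute)
  have "\<iota> (multiple u m) - \<iota> (multiple v m) = \<iota> s"
    unfolding mult[symmetric] sum_subtractf[symmetric] uv[symmetric] by (rule g)
  then have "\<iota> (s + multiple v m) = \<iota> (multiple u m)" by (simp add: add algebra_simps)
  then show ?thesis using injD[OF inj] by blast
qed

context positive_bounded_representation
begin

lemma T_multiple: "T (multiple t n) x = (blinfun_apply (T t) ^^ Suc n) x"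
  by (induction n) (simp_all add: T_add)

end

locale divisible_compact_representation = asymptotically_compact_representation T y
  for T :: "'s::ab_semigroup_add \<Rightarrow> 'a::banach_lattice \<Rightarrow>\<^sub>L 'a" and y :: 'a +
  assumes oc: "order_continuous_norm TYPE('a)"
    and super: "super_fixed_point T x \<Longrightarrow> fixed_point T x"
    and divisible: "\<exists>u v. (s::'s) + multiple v m = multiple u m"
begin

sublocale vector_sublattice L
  using subspace_L abs_in_L[OF oc super] by unfold_locales auto

section \<open>The action on the atoms of \<open>L\<close>\<close>

lemma T_inj_L: "x \<in> L \<Longrightarrow> z \<in> L \<Longrightarrow> T t x = T t z \<Longrightarrow> x = z"
proof -
  assume xz: "x \<in> L" "z \<in> L" "T t x = T t z"
  have "pnorm (x - z) = pnorm (T t (x - z))" using pnorm_T[OF mem_diff[OF xz(1,2)]] by simp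
  also have "\<dots> \<le> 0" using xz(3) pnorm_le[of 0] by (simp add: blinfun.diff_right)
  finally have "norm (x - z) \<le> 0" using norm_le_pnorm[of "x - z"] by linarith
  then show "x = z" by simp
qed

text \<open>Surjectivity on \<open>L\<close> writes a minorant of \<open>T t a\<close> as
  \<open>T t u\<close>, and reflection of positivity puts \<open>u\<close> between zero and
  \<open>a\<close>.\<close>

lemma T_atom:
  assumes a: "atom a" shows "atom (T t a)"
  unfolding atom_def
proof (intro conjI ballI impI)
  have aL: "a \<in> L" "0 \<le> a" "a \<noteq> 0" using a by (auto simp: atom_def)
  show "T t a \<in> L" by (rule T_in_L[OF aL(1)])
  have "T t a \<noteq> 0" using T_inj_L[OF aL(1) mem_zero, of t] aL(3) by (auto simp: blinfun.zero_right)
  then show "0 < T t a" using T_nonneg[OF aL(2)] by (simp add: less_le)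
  fix x assume x: "x \<in> L" "0 \<le> x \<and> x \<le> T t a"
  obtain u where u: "u \<in> L" "T t u = x" using T_surj_L[OF x(1)] by blast
  have "0 \<le> u" using T_reflects_nonneg[OF u(1)] u(2) x(2) by blast
  moreover have "0 \<le> a - u"
    by (rule T_reflects_nonneg[OF mem_diff[OF aL(1) u(1)], of t])
      (use u(2) x(2) in \<open>simp add: blinfun.diff_right\<close>)
  ultimately obtain c where "u = c *\<^sub>R a" using a u(1) unfolding atom_def by auto
  then have "x = c *\<^sub>R T t a" using u(2) by (simp add: blinfun.scaleR_right)
  then show "\<exists>c. x = c *\<^sub>R T t a" ..
qed

text \<open>A non-zero infimum would be a multiple of both atoms and make them proportional; equal
  norms leave only the factors 1 and -1.\<close>

lemma atoms_disjoint:
  assumes a: "atom a" and b: "atom b" and eq: "pnorm a = pnorm b" and ne: "a \<noteq> b"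
  shows "inf a b = 0"
proof (rule ccontr)
  assume m: "inf a b \<noteq> 0"
  have pos: "a \<in> L" "0 \<le> a" "a \<noteq> 0" "b \<in> L" "0 \<le> b" "b \<noteq> 0"
    using a b by (auto simp: atom_def)
  have "inf a b \<in> L" by (rule inf_mem[OF pos(1,4)])
  then obtain c d where c: "inf a b = c *\<^sub>R a" and d: "inf a b = d *\<^sub>R b"
    using a b pos unfolding atom_def by (metis inf_le1 inf_le2 le_inf_iff)
  have c0: "c \<noteq> 0" using c m by auto
  have "a = (1 / c) *\<^sub>R (c *\<^sub>R a)" using c0 by simp
  also have "c *\<^sub>R a = d *\<^sub>R b" using c d by metis
  finally have ab: "a = (d / c) *\<^sub>R b" by simp
  have "norm b > 0" using pos(6) by simp
  then have "pnorm b > 0" using norm_le_pnorm[of b] by linarith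
  moreover have "\<bar>d / c\<bar> * pnorm b = pnorm b" using eq pnorm_scaleR[of "d / c" b] ab by simp
  ultimately have "\<bar>d / c\<bar> = 1" by (auto simp only: mult_cancel_right2)
  then have "d / c = 1 \<or> d / c = - 1" by arith
  then show False
  proof
    assume "d / c = 1" then show False using ab ne by simp
  next
    assume "d / c = - 1"
    then have "a = - b" using ab by simp
    then show False using pos(2,5,6) by (simp add: antisym)
  qed
qed

text \<open>Distinct atoms of this kind are disjoint, so their distance is at least the norm of one
  of them, hence at least \<open>k / bound\<close>. A ball of half that radius contains at most one,
  and finitely many balls suffice.\<close>

lemma finite_atoms:
  assumes "k > 0" shows "finite {b. atom b \<and> b \<le> y \<and> pnorm b = k}"
proof -
  let ?X = "{b. atom b \<and> b \<le> y \<and> pnorm b = k}"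
  define d where "d = k / bound"
  have d: "d / 2 > 0" using assms bound_ge_1 by (simp add: d_def)
  have "?X \<subseteq> {x\<in>L. \<bar>x\<bar> \<le> y}" by (auto simp: atom_def)
  moreover obtain F where F: "finite F" "{x\<in>L. \<bar>x\<bar> \<le> y} \<subseteq> (\<Union>x\<in>F. ball x (d / 2))"
    using compact_L_unit d unfolding compact_eq_totally_bounded by blast
  ultimately have cover: "?X \<subseteq> (\<Union>c\<in>F. ?X \<inter> ball c (d / 2))" by blast
  have sep: "a = b" if a: "a \<in> ?X \<inter> ball c (d / 2)" and b: "b \<in> ?X \<inter> ball c (d / 2)" for a b c
  proof (rule ccontr)
    assume "a \<noteq> b"
    then have "inf a b = 0" using a b by (intro atoms_disjoint) auto
    then have "a + b \<le> \<bar>a - b\<bar>" using add_le_inf_abs_diff[of a b] by simp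
    moreover have "0 \<le> a" "0 \<le> b" using a b by (auto simp: atom_def)
    moreover have "a \<le> a + b" using \<open>0 \<le> b\<close> by simp
    ultimately have "norm a \<le> norm \<bar>a - b\<bar>" using norm_mono_nonneg order_trans by metis
    moreover have "k \<le> bound * norm a" using a pnorm_le[of a] by simp
    then have "d \<le> norm a" using bound_ge_1 by (simp add: d_def pos_divide_le_eq mult.commute)
    moreover have "norm (a - b) < d"
      using a b dist_triangle_half_r[of c a d b] by (simp add: dist_norm)
    ultimately show False by simp
  qed
  have "finite (?X \<inter> ball c (d / 2))" for c
  proof (cases "?X \<inter> ball c (d / 2) = {}")
    case False
    then obtain a where "a \<in> ?X \<inter> ball c (d / 2)" by blast
    then have "?X \<inter> ball c (d / 2) \<subseteq> {a}" using sep[of _ c a] by blast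
    then show ?thesis by (rule finite_subset) simp
  qed (simp only: finite.emptyI)
  then show ?thesis using F(1) by (intro finite_subset[OF cover] finite_UN_I)
qed

lemma T_atom_le_y:
  assumes a: "atom a" "a \<le> y" shows "T s a = a"
proof -
  have a': "a \<in> L" "0 \<le> a" "a \<noteq> 0" using a by (auto simp: atom_def)
  define X where "X = {b. atom b \<and> b \<le> y \<and> pnorm b = pnorm a}"
  have "norm a > 0" using a' by simp
  then have "pnorm a > 0" using norm_le_pnorm[of a] by linarith
  then have fin: "finite X" unfolding X_def by (rule finite_atoms)
  have XL: "b \<in> L" if "b \<in> X" for b using that by (simp add: X_def atom_def)
  have TX: "T t ` X \<subseteq> X" for t
    using T_atom T_mono[of _ y t] pnorm_T XL by (auto simp: X_def T_y)
  have inj: "inj_on (T t) X" for t using T_inj_L XL by (auto simp: inj_on_def)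
  \<comment> \<open>One is subtracted since \<open>multiple t n\<close> stands for
    \<open>n + 1\<close> times \<open>t\<close>.\<close>
  have fix_all: "T (multiple t (fact (card X) - 1)) b = b" if "b \<in> X" for t b
    unfolding T_multiple using funpow_fact_card_eq[OF fin TX inj that, of t] by simp
  obtain u v where uv: "s + multiple v (fact (card X) - 1) = multiple u (fact (card X) - 1)"
    using divisible by blast
  have aX: "a \<in> X" using a by (simp add: X_def)
  have "T s a = T (s + multiple v (fact (card X) - 1)) a"
    unfolding T_add fix_all[OF aX] ..
  then show ?thesis unfolding uv fix_all[OF aX] .
qed

lemma atom_scaleR:
  assumes a: "atom a" and c: "c > 0" shows "atom (c *\<^sub>R a)"
  unfolding atom_def
proof (intro conjI ballI impI)
  have a': "a \<in> L" "0 < a" using a by (auto simp: atom_def)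
  show "c *\<^sub>R a \<in> L" by (rule mem_scaleR[OF a'(1)])
  show "0 < c *\<^sub>R a" using a'(2) c by (auto simp: less_le scaleR_nonneg_nonneg)
  fix x assume x: "x \<in> L" "0 \<le> x \<and> x \<le> c *\<^sub>R a"
  have "(1 / c) *\<^sub>R x \<le> (1 / c) *\<^sub>R (c *\<^sub>R a)" using x c by (intro scaleR_left_mono) auto
  then have "(1 / c) *\<^sub>R x \<le> a" using c by simp
  moreover have "0 \<le> (1 / c) *\<^sub>R x" using x c by (intro scaleR_nonneg_nonneg) auto
  ultimately obtain k where "(1 / c) *\<^sub>R x = k *\<^sub>R a"
    using a mem_scaleR[OF x(1)] unfolding atom_def by blast
  then have "c *\<^sub>R ((1 / c) *\<^sub>R x) = k *\<^sub>R (c *\<^sub>R a)" by simp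
  then show "\<exists>k. x = k *\<^sub>R c *\<^sub>R a" using c by auto
qed

lemma T_atom_eq:
  assumes a: "atom a" shows "T s a = a"
proof -
  have a': "a \<in> L" "0 \<le> a" using a by (auto simp: atom_def)
  obtain c where c: "c > 0" "\<bar>a\<bar> \<le> c *\<^sub>R y"
    using L_bounded[OF a'(1)] .
  have "(1 / c) *\<^sub>R a \<le> y"
    using order_trans[OF abs_ge_self abs_scaleR_inverse_le[OF c]] .
  then have "T s ((1 / c) *\<^sub>R a) = (1 / c) *\<^sub>R a"
    using T_atom_le_y[OF atom_scaleR[OF a]] c(1) by simp
  then show ?thesis using c(1) by (simp add: blinfun.scaleR_right)
qed

text \<open>An atom \<open>a\<close> below the defect \<open>g\<close> could be packed into
  \<open>x\<close> indefinitely: if \<open>n a <= x\<close>, then also \<open>n a <= T s x\<close>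
  because \<open>a\<close> is fixed, so \<open>n a <= x - g\<close> and
  \<open>(n + 1) a <= x\<close>. This contradicts the Archimedean property.\<close>

lemma L_nonneg_super_fixed:
  assumes x: "x \<in> L" "0 \<le> x" shows "x \<le> T s x"
proof -
  define g where "g = x - inf x (T s x)"
  have gL: "g \<in> L" unfolding g_def by (intro mem_diff inf_mem x T_in_L)
  have g0: "0 \<le> g" by (simp add: g_def)
  have gx: "g \<le> x" using x(2) T_nonneg[OF x(2)] by (simp add: g_def)
  obtain c where c: "c > 0" "\<bar>x\<bar> \<le> c *\<^sub>R y"
    using L_bounded[OF x(1)] .
  have "g \<le> c *\<^sub>R y" using gx c(2) x(2) by simp
  then have "{z\<in>L. \<bar>z\<bar> \<le> g} = {z\<in>L. \<bar>z\<bar> \<le> c *\<^sub>R y} \<inter> {z. \<bar>z\<bar> \<le> g}"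
    by (auto intro: order_trans)
  then have "compact {z\<in>L. \<bar>z\<bar> \<le> g}"
    using compact_Int_closed[OF compact_L[OF c(1)] closed_abs_le] by simp
  then interpret compact_interval L g using gL g0 by unfold_locales
  have "g = 0"
  proof (rule ccontr)
    assume "g \<noteq> 0"
    then obtain a where a: "a \<le> g" "atom a" using ex_atom by blast
    have "real n *\<^sub>R a \<le> x" for n
    proof (induction n)
      case (Suc n)
      have "real n *\<^sub>R a \<le> T s x"
        using T_mono[OF Suc, of s] T_atom_eq[OF a(2)] by (simp add: blinfun.scaleR_right)
      then have "real n *\<^sub>R a + a \<le> inf x (T s x) + g"
        using Suc a(1) by (intro add_mono) simp_all
      then show ?case by (simp add: g_def algebra_simps)
    qed (use x in simp)
    then have "a \<le> 0" by (rule le_zero_of_multiples_le)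
    then show False using a(2) by (auto simp: atom_def)
  qed
  then show ?thesis by (simp add: g_def le_iff_inf)
qed

section \<open>Strong convergence\<close>

lemma T_L_eq:
  assumes x: "x \<in> L" shows "T s x = x"
proof -
  have *: "T s z = z" if "z \<in> L" "0 \<le> z" for z
  proof -
    have "super_fixed_point T z"
      using that L_nonneg_super_fixed by (simp add: super_fixed_point_def)
    then show ?thesis using super by (simp add: fixed_point_def)
  qed
  have "x = pprt x - pprt (- x)" using prts[of x] by (simp add: pprt_neg)
  moreover have "T s (pprt x) = pprt x" by (rule * [OF pprt_mem[OF x] zero_le_pprt])
  moreover have "T s (pprt (- x)) = pprt (- x)"
    using subspace_neg[OF subspace x] by (intro * pprt_mem zero_le_pprt)
  ultimately show ?thesis by (metis blinfun.diff_right)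
qed

lemma tendsto_reversible_part:
  assumes w: "w \<in> L" "qnorm (x - w) = 0" shows "((\<lambda>t. T t x) \<longlongrightarrow> w) semigroup_at_top"
proof -
  have "((\<lambda>t. T t (x - w) + w) \<longlongrightarrow> 0 + w) semigroup_at_top"
    by (intro tendsto_add tendsto_zero_semigroup_at_top[OF w(2)] tendsto_const)
  then show ?thesis by (simp add: blinfun.diff_right T_L_eq[OF w(1)])
qed

text \<open>On the principal ideal the limit is the reversible part. It depends on the vector in a
  Lipschitz way with constant \<open>bound\<close>, so limits of approximating vectors converge, and
  boundedness of the representation carries the convergence over to the closure.\<close>

lemma strongly_convergent_of_dense:
  assumes dense: "closure (principal_ideal y) = UNIV"
  shows "strongly_convergent T"
  unfolding strongly_convergent_def
proof (intro allI)
  fix x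
  have "x \<in> closure (principal_ideal y)" using dense by simp
  then obtain X where X: "\<And>n. X n \<in> principal_ideal y" "X \<longlonglongrightarrow> x"
    unfolding closure_sequential by blast
  have "\<exists>w. w \<in> L \<and> qnorm (X n - w) = 0" for n using reversible_part[OF X(1)] by blast
  then obtain W where W: "\<And>n. W n \<in> L" "\<And>n. qnorm (X n - W n) = 0" by metis
  have WX: "norm (W n - W m) \<le> bound * norm (X n - X m)" for n m
  proof -
    have "norm (W n - W m) \<le> qnorm (W n - W m)"
      using norm_le_pnorm[of "W n - W m"] unfolding pnorm_eq_qnorm[OF mem_diff[OF W(1) W(1)]] .
    \<comment> \<open>The null parts \<open>X n - W n\<close> and \<open>X m - W m\<close> are split
      off; they do not contribute to \<open>qnorm\<close>.\<close>
    also have "\<dots> = qnorm ((X n - X m) - ((X n - W n) - (X m - W m)))"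
      by (rule arg_cong[of _ _ qnorm]) simp
    also have "\<dots> \<le> qnorm (X n - X m) + (qnorm (X n - W n) + qnorm (X m - W m))"
      by (rule order_trans[OF qnorm_triangle_diff add_left_mono[OF qnorm_triangle_diff]])
    also have "\<dots> \<le> bound * norm (X n - X m)" using W(2) qnorm_le_norm[of "X n - X m"] by simp
    finally show ?thesis .
  qed
  have "Cauchy W"
  proof (rule metric_CauchyI)
    fix e :: real assume "e > 0"
    then have "e / bound > 0" using bound_ge_1 by simp
    then obtain N where N: "\<And>m n. m \<ge> N \<Longrightarrow> n \<ge> N \<Longrightarrow> dist (X m) (X n) < e / bound"
      using metric_CauchyD[OF LIMSEQ_imp_Cauchy[OF X(2)]] by blast
    have "dist (W m) (W n) < e" if "m \<ge> N" "n \<ge> N" for m n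
      using WX[of m n] N[OF that] bound_ge_1
      by (simp add: dist_norm pos_less_divide_eq mult.commute)
    then show "\<exists>N. \<forall>m\<ge>N. \<forall>n\<ge>N. dist (W m) (W n) < e" by blast
  qed
  then obtain w where w: "W \<longlonglongrightarrow> w" by (auto simp: Cauchy_convergent_iff convergent_def)
  have "((\<lambda>t. T t x) \<longlongrightarrow> w) semigroup_at_top"
  proof (rule tendstoI)
    fix e :: real assume e: "e > 0"
    have pos: "e / (3 * bound) > 0" "e / 3 > 0" using e bound_ge_1 by simp_all
    have "\<forall>\<^sub>F n in sequentially. norm (X n - x) < e / (3 * bound) \<and> norm (W n - w) < e / 3"
      using tendstoD[OF X(2) pos(1)] tendstoD[OF w pos(2)] by (simp add: dist_norm eventually_conj_iff)
    then obtain n where n: "norm (X n - x) < e / (3 * bound)" "norm (W n - w) < e / 3"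
      using eventually_happens by fastforce
    have "\<forall>\<^sub>F t in semigroup_at_top. dist (T t (X n)) (W n) < e / 3"
      by (rule tendstoD[OF tendsto_reversible_part[OF W(1,2)] pos(2)])
    then show "\<forall>\<^sub>F t in semigroup_at_top. dist (T t x) w < e"
    proof eventually_elim
      case (elim t)
      have "bound * norm (X n - x) < e / 3" using n(1) bound_ge_1 by (simp add: field_simps)
      then have "dist (T t x) (T t (X n)) < e / 3"
        using norm_T_apply_le[of t "X n - x"]
        by (simp add: dist_norm blinfun.diff_right norm_minus_commute)
      moreover have "dist (W n) w < e / 3" using n(2) by (simp add: dist_norm)
      ultimately show ?case
        using elim dist_triangle[of "T t x" w "T t (X n)"] dist_triangle[of "T t (X n)" w "W n"]
        by linarith
    qed
  qed
  then show "\<exists>z. ((\<lambda>t. T t x) \<longlongrightarrow> z) semigroup_at_top" ..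
qed

end

theorem theorem3p9:
  fixes \<iota> :: "'s::ab_semigroup_add \<Rightarrow> 'g::ab_group_add"
    and T :: "'s \<Rightarrow> 'a::banach_lattice \<Rightarrow>\<^sub>L 'a"
    and y :: 'a
  assumes "generates_group \<iota>"
    and "divisible_group TYPE('g)"
    and "order_continuous_norm TYPE('a)"
    and "positive_representation T"
    and "bounded_representation T"
    and "quasi_interior_point y" and "fixed_point T y"
    and "\<And>x. super_fixed_point T x \<Longrightarrow> fixed_point T x"
    and "\<And>x. fixed_point T x \<Longrightarrow> x > 0 \<Longrightarrow>
      \<exists>s K. AM_compact K \<and> positive_operator K \<and>
        positive_operator (\<lambda>v. blinfun_apply (T s) v - K v) \<and> K x > 0"
  shows "strongly_convergent T"
proof -
  interpret positive_bounded_representation T y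
    using assms(4-7) by unfold_locales (simp_all add: quasi_interior_point_def)
  interpret divisible_compact_representation T y
    using asymptotically_compact[OF assms(3,8,9)] divisible_group_multiple[OF assms(1,2)] assms(3,8)
    by unfold_locales
  show ?thesis
    using assms(6) by (intro strongly_convergent_of_dense) (simp add: quasi_interior_point_def)
qed

end
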